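(* Let $G$ be an $(s,k)$-edge-connected graph such that $k\geq 2$ and $\deg(s)>4$. Suppose that $L(G,s,k)$ and its complement are both connected (so $I(L(G,s,k))$ is a path or a cycle), let $I_1,\dots,I_m$ be the maximal independent sets of $L(G,s,k)$ in order along this path or cycle, and let $A_i$ be the dangerous set corresponding to $I_i$. Then: (i) If $I(L(G,s,k))$ is a cycle, then $G$ has an $(s,(k-1)/2)$-cycle structure whose blobs are the subgraphs induced by $A_m\cap A_1$ and by $A_i\cap A_{i+1}$ for $i=1,\dots,m-1$. (ii) If $I(L(G,s,k))$ is a path, then $G$ has an $(s,(k-1)/2)$-path structure whose blobs are the subgraphs induced by $A_1\setminus A_2$, by $A_i\cap A_{i+1}$ for $i=1,\dots,m-1$, and by $A_m\setminus A_{m-1}$ (in this order along the path).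
   Context: All graphs are finite loopless multigraphs. $\delta(X)$ is the set of edges with exactly one end in $X$. A graph $G$ is $(s,k)$-edge-connected if $G$ has at least three vertices, $s\in V(G)$, $k$ is a positive integer, and any two vertices of $G$ different from $s$ are joined by $k$ pairwise edge-disjoint paths in $G$ (which may pass through $s$). Lifting edges $sv,sw$ means deleting them and adding $vw$ if $v\ne w$, only deleting them if $v=w$; result $G_{v,w}$. $sv,sw$ are $k$-liftable if $G_{v,w}$ is $(s,k)$-edge-connected. $L(G,s,k)$ has vertex set the edges at $s$, adjacent iff $k$-liftable. A set $A\subseteq V(G)\setminus\{s\}$ is dangerous if $A\ne\emptyset$, $V(G)\setminus(A\cup\{s\})\neq\emptyset$ and $|\delta(A)|\le k+1$. For an independent set $F$ of $L(G,s,k)$ with $|F|\ge 2$ and $F\ne V(L(G,s,k))$, the dangerous set corresponding to $F$ is the unique inclusion-minimal dangerous set containing the end other than $s$ of every edge of $F$. The independence graph $I(H)$ of a graph $H$ has as vertices the maximal independent sets of $H$, two adjacent iff they intersect. Path/cycle structure: for $r\ge1$, $n\ge 3$, pairwise disjoint subgraphs $H_0,\dots,H_{n-1}$ (blobs) of $G-s$ covering $V(G-s)$; $G$ has an $(s,r)$-cycle structure if for every $i$, $\delta(H_i)$ consists of exactly $2r+1$ edges: one to $s$, $r$ to $H_{i-1}$, $r$ to $H_{i+1}$ (indices mod $n$); an $(s,r)$-path structure if this holds for $i=1,\dots,n-2$. *)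

theory Defs
  imports Main
begin

record ('v, 'e) mgraph =
  vertices :: "'v set"
  edges :: "'e set"
  ends :: "'e \<Rightarrow> 'v set"

definition multigraph :: "('v, 'e) mgraph \<Rightarrow> bool" where
  "multigraph G \<longleftrightarrow> finite (vertices G) \<and> finite (edges G) \<and>
     (\<forall>e\<in>edges G. ends G e \<subseteq> vertices G \<and> card (ends G e) = 2)"

definition adjacent :: "('v, 'e) mgraph \<Rightarrow> 'v \<Rightarrow> 'v \<Rightarrow> bool" where
  "adjacent G u v \<longleftrightarrow> (\<exists>e\<in>edges G. ends G e = {u, v})"

definition cut_edges :: "('v, 'e) mgraph \<Rightarrow> 'v set \<Rightarrow> 'e set" where
  "cut_edges G X = {e \<in> edges G. card (ends G e \<inter> X) = 1}"

definition edges_between :: "('v, 'e) mgraph \<Rightarrow> 'v set \<Rightarrow> 'v set \<Rightarrow> 'e set" where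
  "edges_between G X Y = {e \<in> edges G. \<exists>x\<in>X. \<exists>y\<in>Y. ends G e = {x, y}}"

definition edges_at :: "('v, 'e) mgraph \<Rightarrow> 'v \<Rightarrow> 'e set" where
  "edges_at G s = {e \<in> edges G. s \<in> ends G e}"

definition degree :: "('v, 'e) mgraph \<Rightarrow> 'v \<Rightarrow> nat" where
  "degree G s = card (edges_at G s)"

definition subgraph :: "('v, 'e) mgraph \<Rightarrow> ('v, 'e) mgraph \<Rightarrow> bool" where
  "subgraph H G \<longleftrightarrow> multigraph H \<and> vertices H \<subseteq> vertices G \<and> edges H \<subseteq> edges G \<and>
     (\<forall>e\<in>edges H. ends H e = ends G e)"

definition induced_subgraph :: "('v, 'e) mgraph \<Rightarrow> 'v set \<Rightarrow> ('v, 'e) mgraph" where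
  "induced_subgraph G X =
     \<lparr>vertices = X, edges = {e \<in> edges G. ends G e \<subseteq> X}, ends = ends G\<rparr>"

definition delete_vertex :: "('v, 'e) mgraph \<Rightarrow> 'v \<Rightarrow> ('v, 'e) mgraph" where
  "delete_vertex G s = induced_subgraph G (vertices G - {s})"

text \<open>A path is given by its vertex sequence \<open>p\<close> and its edge sequence \<open>es\<close>.\<close>

definition path_between ::
  "('v, 'e) mgraph \<Rightarrow> 'v \<Rightarrow> 'v list \<Rightarrow> 'e list \<Rightarrow> 'v \<Rightarrow> bool" where
  "path_between G u p es v \<longleftrightarrow>
     length p = Suc (length es) \<and> hd p = u \<and> last p = v \<and>
     distinct p \<and> set p \<subseteq> vertices G \<and>
     (\<forall>i<length es. es ! i \<in> edges G \<and> ends G (es ! i) = {p ! i, p ! Suc i})"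

definition edge_disjoint_paths :: "('v, 'e) mgraph \<Rightarrow> nat \<Rightarrow> 'v \<Rightarrow> 'v \<Rightarrow> bool" where
  "edge_disjoint_paths G k u v \<longleftrightarrow>
     (\<exists>p es. (\<forall>i<k. path_between G u (p i) (es i) v) \<and>
             (\<forall>i<k. \<forall>j<k. i \<noteq> j \<longrightarrow> set (es i) \<inter> set (es j) = {}))"

definition connected_graph :: "('v, 'e) mgraph \<Rightarrow> bool" where
  "connected_graph G \<longleftrightarrow> vertices G \<noteq> {} \<and>
     (\<forall>u\<in>vertices G. \<forall>v\<in>vertices G. \<exists>p es. path_between G u p es v)"

definition sk_edge_connected :: "('v, 'e) mgraph \<Rightarrow> 'v \<Rightarrow> nat \<Rightarrow> bool" where
  "sk_edge_connected G s k \<longleftrightarrow> 3 \<le> card (vertices G) \<and> s \<in> vertices G \<and> 1 \<le> k \<and>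
     (\<forall>u\<in>vertices G - {s}. \<forall>v\<in>vertices G - {s}. u \<noteq> v \<longrightarrow> edge_disjoint_paths G k u v)"

text \<open>Simple graphs are multigraphs whose edges are two-element sets of vertices,
  each being its own set of ends.\<close>

definition simple_graph :: "'a set \<Rightarrow> ('a \<Rightarrow> 'a \<Rightarrow> bool) \<Rightarrow> ('a, 'a set) mgraph" where
  "simple_graph V R =
     \<lparr>vertices = V, edges = {{x, y} | x y. x \<in> V \<and> y \<in> V \<and> x \<noteq> y \<and> R x y}, ends = (\<lambda>e. e)\<rparr>"

definition complement_graph :: "('a, 'a set) mgraph \<Rightarrow> ('a, 'a set) mgraph" where
  "complement_graph H = simple_graph (vertices H) (\<lambda>x y. \<not> adjacent H x y)"

definition independent_set :: "('v, 'e) mgraph \<Rightarrow> 'v set \<Rightarrow> bool" where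
  "independent_set H F \<longleftrightarrow> F \<subseteq> vertices H \<and> (\<forall>x\<in>F. \<forall>y\<in>F. \<not> adjacent H x y)"

definition max_independent_set :: "('v, 'e) mgraph \<Rightarrow> 'v set \<Rightarrow> bool" where
  "max_independent_set H F \<longleftrightarrow> independent_set H F \<and>
     (\<forall>F'. independent_set H F' \<and> F \<subseteq> F' \<longrightarrow> F' = F)"

definition independence_graph :: "('v, 'e) mgraph \<Rightarrow> ('v set, 'v set set) mgraph" where
  "independence_graph H =
     simple_graph {F. max_independent_set H F} (\<lambda>F F'. F \<inter> F' \<noteq> {})"

text \<open>\<open>path_order H m x\<close>: the simple graph \<open>H\<close> is a path with vertices
  \<open>x 1, \<dots>, x m\<close> in this order; \<open>cycle_order H m x\<close> likewise for a cycle.\<close>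

definition path_order :: "('a, 'a set) mgraph \<Rightarrow> nat \<Rightarrow> (nat \<Rightarrow> 'a) \<Rightarrow> bool" where
  "path_order H m x \<longleftrightarrow> 1 \<le> m \<and> bij_betw x {1..m} (vertices H) \<and>
     (\<forall>i\<in>{1..m}. \<forall>j\<in>{1..m}. adjacent H (x i) (x j) \<longleftrightarrow> j = i + 1 \<or> i = j + 1)"

definition cycle_order :: "('a, 'a set) mgraph \<Rightarrow> nat \<Rightarrow> (nat \<Rightarrow> 'a) \<Rightarrow> bool" where
  "cycle_order H m x \<longleftrightarrow> 3 \<le> m \<and> bij_betw x {1..m} (vertices H) \<and>
     (\<forall>i\<in>{1..m}. \<forall>j\<in>{1..m}. adjacent H (x i) (x j) \<longleftrightarrow>
        j = i + 1 \<or> i = j + 1 \<or> (i = 1 \<and> j = m) \<or> (i = m \<and> j = 1))"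

definition is_path_graph :: "('a, 'a set) mgraph \<Rightarrow> bool" where
  "is_path_graph H \<longleftrightarrow> (\<exists>m x. path_order H m x)"

definition is_cycle_graph :: "('a, 'a set) mgraph \<Rightarrow> bool" where
  "is_cycle_graph H \<longleftrightarrow> (\<exists>m x. cycle_order H m x)"

definition other_end :: "('v, 'e) mgraph \<Rightarrow> 'v \<Rightarrow> 'e \<Rightarrow> 'v" where
  "other_end G s e = (THE v. ends G e = {s, v})"

text \<open>Lifting two distinct edges \<open>e\<close>, \<open>f\<close> at \<open>s\<close>. The name \<open>e\<close>, freed by the deletion,
  is reused for the new edge; using \<open>f\<close> instead gives an isomorphic graph.\<close>

definition lift_edges :: "('v, 'e) mgraph \<Rightarrow> 'v \<Rightarrow> 'e \<Rightarrow> 'e \<Rightarrow> ('v, 'e) mgraph" where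
  "lift_edges G s e f =
     (let v = other_end G s e; w = other_end G s f in
      if v = w then G\<lparr>edges := edges G - {e, f}\<rparr>
      else G\<lparr>edges := edges G - {f}, ends := (ends G)(e := {v, w})\<rparr>)"

definition liftable :: "('v, 'e) mgraph \<Rightarrow> 'v \<Rightarrow> nat \<Rightarrow> 'e \<Rightarrow> 'e \<Rightarrow> bool" where
  "liftable G s k e f \<longleftrightarrow> sk_edge_connected (lift_edges G s e f) s k"

definition lifting_graph :: "('v, 'e) mgraph \<Rightarrow> 'v \<Rightarrow> nat \<Rightarrow> ('e, 'e set) mgraph" where
  "lifting_graph G s k = simple_graph (edges_at G s) (liftable G s k)"

definition dangerous :: "('v, 'e) mgraph \<Rightarrow> 'v \<Rightarrow> nat \<Rightarrow> 'v set \<Rightarrow> bool" where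
  "dangerous G s k A \<longleftrightarrow> A \<subseteq> vertices G - {s} \<and> A \<noteq> {} \<and>
     vertices G - (A \<union> {s}) \<noteq> {} \<and> card (cut_edges G A) \<le> k + 1"

definition min_dangerous_for ::
  "('v, 'e) mgraph \<Rightarrow> 'v \<Rightarrow> nat \<Rightarrow> 'e set \<Rightarrow> 'v set \<Rightarrow> bool" where
  "min_dangerous_for G s k F A \<longleftrightarrow>
     dangerous G s k A \<and> other_end G s ` F \<subseteq> A \<and>
     (\<forall>B. dangerous G s k B \<and> other_end G s ` F \<subseteq> B \<and> B \<subseteq> A \<longrightarrow> B = A)"

definition dangerous_set_of :: "('v, 'e) mgraph \<Rightarrow> 'v \<Rightarrow> nat \<Rightarrow> 'e set \<Rightarrow> 'v set" where
  "dangerous_set_of G s k F = (THE A. min_dangerous_for G s k F A)"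

definition blobs :: "('v, 'e) mgraph \<Rightarrow> 'v \<Rightarrow> nat \<Rightarrow> (nat \<Rightarrow> ('v, 'e) mgraph) \<Rightarrow> bool" where
  "blobs G s n H \<longleftrightarrow> 3 \<le> n \<and>
     (\<forall>i<n. subgraph (H i) (delete_vertex G s)) \<and>
     (\<forall>i<n. \<forall>j<n. i \<noteq> j \<longrightarrow> vertices (H i) \<inter> vertices (H j) = {}) \<and>
     (\<Union>i<n. vertices (H i)) = vertices (delete_vertex G s)"

definition regular_blob ::
  "('v, 'e) mgraph \<Rightarrow> 'v \<Rightarrow> nat \<Rightarrow> ('v, 'e) mgraph \<Rightarrow> ('v, 'e) mgraph \<Rightarrow> ('v, 'e) mgraph \<Rightarrow> bool"
where
  "regular_blob G s r P B N \<longleftrightarrow>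
     card (cut_edges G (vertices B)) = 2 * r + 1 \<and>
     card (edges_between G (vertices B) {s}) = 1 \<and>
     card (edges_between G (vertices B) (vertices P)) = r \<and>
     card (edges_between G (vertices B) (vertices N)) = r"

definition cycle_structure ::
  "('v, 'e) mgraph \<Rightarrow> 'v \<Rightarrow> nat \<Rightarrow> nat \<Rightarrow> (nat \<Rightarrow> ('v, 'e) mgraph) \<Rightarrow> bool" where
  "cycle_structure G s r n H \<longleftrightarrow> 1 \<le> r \<and> blobs G s n H \<and>
     (\<forall>i<n. regular_blob G s r (H ((i + n - 1) mod n)) (H i) (H ((i + 1) mod n)))"

definition path_structure ::
  "('v, 'e) mgraph \<Rightarrow> 'v \<Rightarrow> nat \<Rightarrow> nat \<Rightarrow> (nat \<Rightarrow> ('v, 'e) mgraph) \<Rightarrow> bool" where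
  "path_structure G s r n H \<longleftrightarrow> 1 \<le> r \<and> blobs G s n H \<and>
     (\<forall>i\<in>{1..n-2}. regular_blob G s r (H (i - 1)) (H i) (H (i + 1)))"

end

theory Submission imports Defs begin

text \<open>
  By Menger's theorem two edges at \<open>s\<close> fail to be liftable exactly when some dangerous set contains
  both other ends. Let \<open>A\<close>, \<open>B\<close> be incomparable dangerous sets whose intersection has an edge
  to \<open>s\<close>. The identity \<open>d A + d B = d (A - B) + d (B - A) + 2 e (A \<inter> B, V - (A \<union> B))\<close>
  shows that this edge is the only one from \<open>A \<inter> B\<close> to the outside of \<open>A \<union> B\<close>. Hence dangerous sets
  that share two edges to \<open>s\<close> are comparable, and every independent set with at least two elements
  lies in a single dangerous set (here \<open>deg s > 4\<close> is needed).

  If \<open>A\<close>, \<open>B\<close> correspond to distinct intersecting maximal independent sets, then \<open>A \<union> B\<close> is not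
  dangerous, and submodularity forces \<open>d (A \<inter> B) = k\<close>, no edges between \<open>A - B\<close> and \<open>B - A\<close>, and
  exactly \<open>(k - 1) / 2\<close> edges from \<open>A \<inter> B\<close> to each of them; in particular \<open>k\<close> is odd. For odd \<open>k\<close>,
  sets with \<open>d = k\<close> do not cross, so the intersections of \<open>A\<close> with its neighbours are disjoint.
  Each of them uses \<open>(k + 1) / 2\<close> of the \<open>k + 1\<close> edges leaving \<open>A\<close>, so there are at most two, and if
  there are two, they fill \<open>A\<close>. This yields both the path or cycle shape of the independence graph
  and the blobs.
\<close>

section \<open>Menger's theorem\<close>

text \<open>Walks as lists of (edge, next vertex) pairs suit recursion better than the two lists of
  \<open>path_between\<close>. The step relation is a parameter because two kinds of steps occur:
  edges with room for more flow and edges that carry flow.\<close>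

fun arc_path :: "('v \<Rightarrow> 'e \<Rightarrow> 'v \<Rightarrow> bool) \<Rightarrow> 'v \<Rightarrow> ('e \<times> 'v) list \<Rightarrow> 'v \<Rightarrow> bool" where
  "arc_path P u [] v \<longleftrightarrow> u = v"
| "arc_path P u ((e, w) # ps) v \<longleftrightarrow> P u e w \<and> arc_path P w ps v"

lemma arc_path_suffix: "arc_path P u (xs @ (e, y) # ys) v \<Longrightarrow> arc_path P y ys v"
  by (induction xs arbitrary: u) auto

text \<open>Prepending a step may repeat the vertex \<open>y\<close>; then the suffix after its
  earlier occurrence is taken, which keeps the vertices distinct.\<close>

lemma rtranclp_imp_arc_path:
  assumes "(\<lambda>x y. \<exists>e. P x e y)\<^sup>*\<^sup>* u v"
  shows "\<exists>ps. arc_path P u ps v \<and> distinct (u # map snd ps)"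
  using assms
proof (induction rule: converse_rtranclp_induct)
  case base
  show ?case by (rule exI[of _ "[]"]) simp
next
  case (step y z)
  then obtain e ps where e: "P y e z" and ps: "arc_path P z ps v" "distinct (z # map snd ps)"
    by blast
  show ?case
  proof (cases "y \<in> set (z # map snd ps)")
    case False
    then show ?thesis using e ps by (intro exI[of _ "(e, z) # ps"]) auto
  next
    case True
    show ?thesis
    proof (cases "y = z")
      case True
      then show ?thesis using ps by blast
    next
      case False
      with True obtain e' where "(e', y) \<in> set ps" by auto
      then obtain xs ys where eq: "ps = xs @ (e', y) # ys" by (meson split_list)
      then show ?thesis using ps arc_path_suffix[of P z xs e' y ys v]
        by (intro exI[of _ ys]) auto
    qed
  qed
qed

lemma arc_path_nth:
  assumes "arc_path P u ps v"
  shows "last (u # map snd ps) = v"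
    and "i < length ps \<Longrightarrow> P ((u # map snd ps) ! i) (map fst ps ! i) ((u # map snd ps) ! Suc i)"
proof -
  show "last (u # map snd ps) = v"
    using assms by (induction ps arbitrary: u) (auto split: if_splits)
  show "P ((u # map snd ps) ! i) (map fst ps ! i) ((u # map snd ps) ! Suc i)" if "i < length ps"
    using assms that
  proof (induction ps arbitrary: u i)
    case (Cons a ps)
    then show ?case by (cases a; cases i) auto
  qed simp
qed

lemma arc_path_mono:
  assumes "arc_path P u ps v" and "\<And>x e y. e \<in> fst ` set ps \<Longrightarrow> P x e y \<Longrightarrow> Q x e y"
  shows "arc_path Q u ps v"
  using assms by (induction ps arbitrary: u) auto

text \<open>With distinct vertices, this shows that the edge leaving the first vertex of a path
  cannot recur further on.\<close>

lemma arc_path_ends: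
  assumes "arc_path P u ps v" and "\<And>x e y. P x e y \<Longrightarrow> ends G e = {x, y}"
    and "e \<in> fst ` set ps"
  shows "ends G e \<subseteq> insert u (snd ` set ps)"
  using assms(1,3)
proof (induction ps arbitrary: u)
  case (Cons a ps)
  obtain e' w where a: "a = (e', w)" by (cases a)
  then have "ends G e' = {u, w}" "arc_path P w ps v" using Cons.prems assms(2) by auto
  then show ?case using Cons.IH[of w] Cons.prems(2) a by auto
qed simp

text \<open>A unit flow is recorded by \<open>g e x\<close>, the net amount leaving \<open>x\<close> through \<open>e\<close>.\<close>

definition unit_flow :: "('v, 'e) mgraph \<Rightarrow> 'e set \<Rightarrow> ('e \<Rightarrow> 'v \<Rightarrow> int) \<Rightarrow> bool" where
  "unit_flow G E g \<longleftrightarrow> (\<forall>e\<in>E. (\<forall>x. x \<notin> ends G e \<longrightarrow> g e x = 0) \<and>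
     (\<forall>x y. ends G e = {x, y} \<longrightarrow> x \<noteq> y \<longrightarrow> g e x + g e y = 0) \<and> (\<forall>x. \<bar>g e x\<bar> \<le> 1))"

section \<open>Integral flows: value across cuts, augmentation, decomposition\<close>

definition net_out :: "'e set \<Rightarrow> ('e \<Rightarrow> 'v \<Rightarrow> int) \<Rightarrow> 'v \<Rightarrow> int" where
  "net_out E g z = (\<Sum>e\<in>E. g e z)"

lemma multigraph_ends_cases:
  assumes "multigraph G" "e \<in> edges G"
  obtains x y where "ends G e = {x, y}" "x \<noteq> y" "x \<in> vertices G" "y \<in> vertices G"
proof -
  have "card (ends G e) = 2" "ends G e \<subseteq> vertices G"
    using assms by (auto simp: multigraph_def)
  then show thesis using that by (auto simp: card_2_iff)
qed

lemma card_pair_Int_eq_1: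
  "x \<noteq> y \<Longrightarrow> card ({x, y} \<inter> X) = 1 \<longleftrightarrow> (x \<in> X) \<noteq> (y \<in> X)"
  by (cases "x \<in> X"; cases "y \<in> X") (auto simp: Int_insert_left)

text \<open>An edge with both ends in \<open>X\<close> cancels by skew symmetry, and one with no end
  in \<open>X\<close> contributes 0. For a cut edge, \<open>ends G e \<inter> X\<close> is a
  singleton, so the inner sum is the flow out of \<open>X\<close> along it.\<close>

lemma sum_net_out:
  assumes G: "multigraph G" and E: "E \<subseteq> edges G" and g: "unit_flow G E g"
    and X: "X \<subseteq> vertices G"
  shows "(\<Sum>z\<in>X. net_out E g z) =
    (\<Sum>e\<in>{e\<in>E. card (ends G e \<inter> X) = 1}. \<Sum>z\<in>ends G e \<inter> X. g e z)"
proof -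
  have finE: "finite E" and finX: "finite X"
    using G E X by (auto simp: multigraph_def finite_subset)
  have "(\<Sum>z\<in>X. net_out E g z) = (\<Sum>e\<in>E. \<Sum>z\<in>X. g e z)"
    unfolding net_out_def by (rule sum.swap)
  also have "\<dots> = (\<Sum>e\<in>E. if card (ends G e \<inter> X) = 1 then \<Sum>z\<in>ends G e \<inter> X. g e z else 0)"
  proof (rule sum.cong[OF refl])
    fix e assume e: "e \<in> E"
    then have "e \<in> edges G" using E by blast
    then obtain x y where xy: "ends G e = {x, y}" "x \<noteq> y"
      by (rule multigraph_ends_cases[OF G])
    have g0: "\<And>z. z \<notin> {x, y} \<Longrightarrow> g e z = 0" and gxy: "g e x + g e y = 0"
      using g e xy unfolding unit_flow_def by blast+
    have "(\<Sum>z\<in>X. g e z) = (\<Sum>z\<in>ends G e \<inter> X. g e z)"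
      using g0 finX xy(1) by (intro sum.mono_neutral_right) auto
    moreover have "(\<Sum>z\<in>ends G e \<inter> X. g e z) = 0" if "card (ends G e \<inter> X) \<noteq> 1"
    proof -
      have "ends G e \<inter> X = {} \<or> ends G e \<inter> X = {x, y}"
        using that card_pair_Int_eq_1[of x y X] xy by auto
      then show ?thesis using xy(2) gxy by (elim disjE) simp_all
    qed
    ultimately show "(\<Sum>z\<in>X. g e z) =
        (if card (ends G e \<inter> X) = 1 then \<Sum>z\<in>ends G e \<inter> X. g e z else 0)" by simp
  qed
  finally show ?thesis using finE by (simp add: sum.inter_filter)
qed

text \<open>Here \<open>g e x \<le> 0\<close> says that \<open>e\<close> does not yet carry a unit
  out of \<open>x\<close>, so raising \<open>g e x\<close> by one keeps it at most 1. The induction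
  pushes the unit along one edge at a time.\<close>

lemma augment_unit_flow:
  assumes "finite E" "unit_flow G E g"
    and "arc_path (\<lambda>x e y. e \<in> E \<and> ends G e = {x, y} \<and> g e x \<le> 0) u ps v"
    and "distinct (u # map snd ps)"
  shows "\<exists>g'. unit_flow G E g' \<and>
    (\<forall>z. net_out E g' z = net_out E g z + of_bool (z = u) - of_bool (z = v))"
  using assms(2-4)
proof (induction ps arbitrary: u g)
  case Nil
  then show ?case by (intro exI[of _ g]) auto
next
  case (Cons a ps)
  obtain e w where a: "a = (e, w)" by (cases a)
  have e: "e \<in> E" "ends G e = {u, w}" "g e u \<le> 0" and neq: "u \<noteq> w"
    using Cons.prems a by auto
  define h where "h = (\<lambda>z. g e z + of_bool (z = u) - of_bool (z = w))"
  define g1 where "g1 = g(e := h)"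
  have gw: "g e u + g e w = 0" "\<bar>g e u\<bar> \<le> 1" "\<bar>g e w\<bar> \<le> 1" "\<And>z. z \<notin> {u, w} \<Longrightarrow> g e z = 0"
    using Cons.prems(1) e neq unfolding unit_flow_def by blast+
  have abs: "\<bar>h z\<bar> \<le> 1" for z
    using gw e(3) neq by (cases "z = u"; cases "z = w") (simp_all add: h_def)
  have skew: "h x + h y = 0" if "{u, w} = {x, y}" "x \<noteq> y" for x y
    using that gw(1) neq unfolding doubleton_eq_iff h_def by (elim disjE) simp_all
  have flow1: "unit_flow G E g1"
    unfolding unit_flow_def
  proof (intro ballI)
    fix e' assume e': "e' \<in> E"
    show "(\<forall>x. x \<notin> ends G e' \<longrightarrow> g1 e' x = 0) \<and>
      (\<forall>x y. ends G e' = {x, y} \<longrightarrow> x \<noteq> y \<longrightarrow> g1 e' x + g1 e' y = 0) \<and> (\<forall>x. \<bar>g1 e' x\<bar> \<le> 1)"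
    proof (cases "e' = e")
      case True
      then show ?thesis using abs skew gw(4) by (simp add: g1_def e(2)) (simp add: h_def)
    next
      case False
      then show ?thesis using Cons.prems(1) e' by (simp add: g1_def unit_flow_def)
    qed
  qed
  have net1: "net_out E g1 z = net_out E g z + of_bool (z = u) - of_bool (z = w)" for z
    using e(1) assms(1) by (simp add: net_out_def g1_def h_def sum.remove[of E e] cong: sum.cong_simp)
  \<comment> \<open>The update touches only \<open>e\<close>; as \<open>e\<close> does not recur,
    the rest of the path stays residual for \<open>g1\<close>.\<close>
  have "e \<notin> fst ` set ps"
  proof
    assume in_ps: "e \<in> fst ` set ps"
    have "arc_path (\<lambda>x e y. e \<in> E \<and> ends G e = {x, y} \<and> g e x \<le> 0) w ps v"
      using Cons.prems(2) a by simp
    then have "ends G e \<subseteq> insert w (snd ` set ps)"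
      by (rule arc_path_ends[OF _ _ in_ps]) simp
    then show False using Cons.prems(3) a e by auto
  qed
  then have g1_eq: "g1 e' = g e'" if "e' \<in> fst ` set ps" for e'
    using that by (auto simp: g1_def)
  have "arc_path (\<lambda>x e y. e \<in> E \<and> ends G e = {x, y} \<and> g e x \<le> 0) w ps v"
    using Cons.prems(2) a by simp
  then have "arc_path (\<lambda>x e y. e \<in> E \<and> ends G e = {x, y} \<and> g1 e x \<le> 0) w ps v"
    by (rule arc_path_mono) (simp add: g1_eq)
  from Cons.IH[OF flow1 this] Cons.prems(3) a obtain g' where
    "unit_flow G E g'"
    "\<forall>z. net_out E g' z = net_out E g1 z + of_bool (z = w) - of_bool (z = v)" by auto
  then show ?case using net1 by (intro exI[of _ g']) simp
qed

text \<open>Hence deleting the edges of such a path leaves a flow whose value is smaller by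
  one.\<close>

lemma net_out_arc_path:
  assumes "unit_flow G E g"
    and "arc_path (\<lambda>x e y. e \<in> E \<and> ends G e = {x, y} \<and> g e x = 1) u ps v"
    and "distinct (u # map snd ps)"
  shows "net_out (fst ` set ps) g z = of_bool (z = u) - of_bool (z = v)"
  using assms(2-3)
proof (induction ps arbitrary: u)
  case Nil
  then show ?case by (simp add: net_out_def)
next
  case (Cons a ps)
  obtain e w where a: "a = (e, w)" by (cases a)
  have e: "e \<in> E" "ends G e = {u, w}" "g e u = 1" and neq: "u \<noteq> w"
    using Cons.prems a by auto
  have gw: "g e u + g e w = 0" "\<And>z. z \<notin> {u, w} \<Longrightarrow> g e z = 0"
    using assms(1) e neq unfolding unit_flow_def by blast+
  have "e \<notin> fst ` set ps"
  proof
    assume in_ps: "e \<in> fst ` set ps"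
    have "arc_path (\<lambda>x e y. e \<in> E \<and> ends G e = {x, y} \<and> g e x = 1) w ps v"
      using Cons.prems(1) a by simp
    then have "ends G e \<subseteq> insert w (snd ` set ps)"
      by (rule arc_path_ends[OF _ _ in_ps]) simp
    then show False using Cons.prems(2) a e by auto
  qed
  then have "net_out (fst ` set (a # ps)) g z = g e z + net_out (fst ` set ps) g z"
    by (simp add: net_out_def a)
  moreover have "net_out (fst ` set ps) g z = of_bool (z = w) - of_bool (z = v)"
    using Cons.prems a by (intro Cons.IH) auto
  ultimately show ?case
    using e gw neq by (cases "z = u"; cases "z = w") auto
qed

text \<open>\<open>X\<close> collects what \<open>u\<close> reaches along steps satisfying
  \<open>Q\<close>, so no edge leaving \<open>X\<close> satisfies \<open>Q\<close>, and by
  conservation the value of the flow is its net amount across \<open>X\<close>. It is used with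
  \<open>t \<le> 0\<close> to augment and with \<open>t = 1\<close> to extract paths.\<close>

lemma flow_across_reachable_set:
  assumes G: "multigraph G" and E: "E \<subseteq> edges G" and g: "unit_flow G E g"
    and uv: "u \<in> vertices G" "v \<in> vertices G" "u \<noteq> v"
    and cons: "\<forall>z\<in>vertices G. z \<noteq> u \<longrightarrow> z \<noteq> v \<longrightarrow> net_out E g z = 0"
    and no: "\<not> (\<lambda>x y. \<exists>e. e \<in> E \<and> ends G e = {x, y} \<and> Q (g e x))\<^sup>*\<^sup>* u v"
  shows "\<exists>X. X \<subseteq> vertices G \<and> u \<in> X \<and> v \<notin> X \<and>
    net_out E g u = (\<Sum>e\<in>{e\<in>E. card (ends G e \<inter> X) = 1}. \<Sum>z\<in>ends G e \<inter> X. g e z) \<and>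
    (\<forall>e\<in>E. card (ends G e \<inter> X) = 1 \<longrightarrow> \<not> Q (\<Sum>z\<in>ends G e \<inter> X. g e z))"
proof -
  let ?R = "\<lambda>x y. \<exists>e. e \<in> E \<and> ends G e = {x, y} \<and> Q (g e x)"
  define X where "X = {z \<in> vertices G. ?R\<^sup>*\<^sup>* u z}"
  have X: "X \<subseteq> vertices G" "u \<in> X" "v \<notin> X" using uv no by (auto simp: X_def)
  have finX: "finite X" using X(1) G by (auto simp: multigraph_def finite_subset)
  have "(\<Sum>z\<in>X. net_out E g z) = net_out E g u + (\<Sum>z\<in>X-{u}. net_out E g z)"
    using X finX by (simp add: sum.remove)
  also have "(\<Sum>z\<in>X-{u}. net_out E g z) = 0"
    using X cons by (intro sum.neutral) auto
  finally have "net_out E g u = (\<Sum>e\<in>{e\<in>E. card (ends G e \<inter> X) = 1}. \<Sum>z\<in>ends G e \<inter> X. g e z)"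
    using sum_net_out[OF G E g X(1)] by simp
  moreover have "\<not> Q (\<Sum>z\<in>ends G e \<inter> X. g e z)" if e: "e \<in> E" "card (ends G e \<inter> X) = 1" for e
  proof
    assume q: "Q (\<Sum>z\<in>ends G e \<inter> X. g e z)"
    have "e \<in> edges G" using E e by blast
    then obtain x y where "ends G e = {x, y}" "x \<noteq> y" "x \<in> vertices G" "y \<in> vertices G"
      by (rule multigraph_ends_cases[OF G])
    moreover from this have "(x \<in> X) \<noteq> (y \<in> X)" using e card_pair_Int_eq_1 by metis
    ultimately obtain x y where xy: "ends G e = {x, y}" "x \<in> X" "y \<notin> X" "y \<in> vertices G"
      by (metis insert_commute)
    then have "ends G e \<inter> X = {x}" by auto
    then have "?R x y" using q xy e by (auto intro!: exI[of _ e])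
    then have "y \<in> X" using xy by (auto simp: X_def intro: rtranclp.rtrancl_into_rtrancl)
    then show False using xy by simp
  qed
  ultimately show ?thesis using X by blast
qed

text \<open>Ford-Fulkerson, by induction on the value. Without an augmenting path every edge leaving
  the reachable set carries a full unit outwards, so \<open>j\<close> is at least the size of a cut,
  against \<open>j < k\<close>.\<close>

lemma exists_unit_flow:
  assumes G: "multigraph G" and uv: "u \<in> vertices G" "v \<in> vertices G" "u \<noteq> v"
    and cut: "\<And>X. X \<subseteq> vertices G \<Longrightarrow> u \<in> X \<Longrightarrow> v \<notin> X \<Longrightarrow> k \<le> card (cut_edges G X)"
    and "j \<le> k"
  shows "\<exists>g. unit_flow G (edges G) g \<and> net_out (edges G) g u = int j \<and>
    (\<forall>z\<in>vertices G. z \<noteq> u \<longrightarrow> z \<noteq> v \<longrightarrow> net_out (edges G) g z = 0)"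
  using \<open>j \<le> k\<close>
proof (induction j)
  case 0
  show ?case by (rule exI[of _ "\<lambda>_ _. 0"]) (auto simp: unit_flow_def net_out_def)
next
  case (Suc j)
  then obtain g where g: "unit_flow G (edges G) g" "net_out (edges G) g u = int j"
    "\<forall>z\<in>vertices G. z \<noteq> u \<longrightarrow> z \<noteq> v \<longrightarrow> net_out (edges G) g z = 0" by auto
  have fin: "finite (edges G)" using G by (simp add: multigraph_def)
  have "(\<lambda>x y. \<exists>e. e \<in> edges G \<and> ends G e = {x, y} \<and> g e x \<le> 0)\<^sup>*\<^sup>* u v"
  proof (rule ccontr)
    assume no: "\<not> ?thesis"
    obtain X where X: "X \<subseteq> vertices G" "u \<in> X" "v \<notin> X"
      and eq: "net_out (edges G) g u =
         (\<Sum>e\<in>{e\<in>edges G. card (ends G e \<inter> X) = 1}. \<Sum>z\<in>ends G e \<inter> X. g e z)"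
      and pos: "\<forall>e\<in>edges G. card (ends G e \<inter> X) = 1 \<longrightarrow>
         \<not> (\<Sum>z\<in>ends G e \<inter> X. g e z) \<le> 0"
      using flow_across_reachable_set[OF G subset_refl g(1) uv g(3), where Q = "\<lambda>t. t \<le> 0", OF no] by blast
    have "int (card (cut_edges G X)) =
        (\<Sum>e\<in>{e\<in>edges G. card (ends G e \<inter> X) = 1}. 1)"
      by (simp add: cut_edges_def)
    also have "\<dots> \<le> (\<Sum>e\<in>{e\<in>edges G. card (ends G e \<inter> X) = 1}. \<Sum>z\<in>ends G e \<inter> X. g e z)"
      using pos by (intro sum_mono) force
    finally have "int (card (cut_edges G X)) \<le> int j" using eq g(2) by simp
    then show False using cut[OF X] Suc.prems by linarith
  qed
  from rtranclp_imp_arc_path[OF this] obtain ps where "arc_path (\<lambda>x e y. e \<in> edges G \<and> ends G e = {x, y} \<and> g e x \<le> 0) u ps v"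
    "distinct (u # map snd ps)" by blast
  from augment_unit_flow[OF fin g(1) this] obtain g' where "unit_flow G (edges G) g'"
    "\<And>z. net_out (edges G) g' z = net_out (edges G) g z + of_bool (z = u) - of_bool (z = v)"
    by blast
  then show ?case using g uv by (intro exI[of _ g']) auto
qed

text \<open>Paths are peeled off one at a time; \<open>g\<close> stays fixed and only its edge set
  \<open>E\<close> shrinks, which gives disjointness. A path exists while the value is positive:
  otherwise no edge leaving the reachable set would carry a positive amount.\<close>

lemma unit_flow_decompose:
  assumes G: "multigraph G" and uv: "u \<in> vertices G" "v \<in> vertices G" "u \<noteq> v"
    and "E \<subseteq> edges G" "unit_flow G E g" "net_out E g u = int j"
    and "\<forall>z\<in>vertices G. z \<noteq> u \<longrightarrow> z \<noteq> v \<longrightarrow> net_out E g z = 0"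
  shows "\<exists>p es. (\<forall>i<j. path_between G u (p i) (es i) v \<and> set (es i) \<subseteq> E) \<and>
             (\<forall>i<j. \<forall>i'<j. i \<noteq> i' \<longrightarrow> set (es i) \<inter> set (es i') = {})"
  using assms(5-)
proof (induction j arbitrary: E)
  case 0
  then show ?case by simp
next
  case (Suc j)
  have "(\<lambda>x y. \<exists>e. e \<in> E \<and> ends G e = {x, y} \<and> g e x = 1)\<^sup>*\<^sup>* u v"
  proof (rule ccontr)
    assume no: "\<not> ?thesis"
    obtain X where eq: "net_out E g u =
         (\<Sum>e\<in>{e\<in>E. card (ends G e \<inter> X) = 1}. \<Sum>z\<in>ends G e \<inter> X. g e z)"
      and pos: "\<forall>e\<in>E. card (ends G e \<inter> X) = 1 \<longrightarrow>
         \<not> (\<Sum>z\<in>ends G e \<inter> X. g e z) = 1"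
      using flow_across_reachable_set[OF G Suc.prems(1,2) uv Suc.prems(4), where Q = "\<lambda>t. t = 1", OF no] by blast
    have nonpos: "(\<Sum>z\<in>ends G e \<inter> X. g e z) \<le> 0" if e: "e \<in> E" "card (ends G e \<inter> X) = 1" for e
    proof -
      obtain x where x: "ends G e \<inter> X = {x}" using e(2) by (rule card_1_singletonE)
      have "\<bar>g e x\<bar> \<le> 1" using Suc.prems(2) e(1) by (simp add: unit_flow_def)
      moreover have "g e x \<noteq> 1" using pos e x by auto
      ultimately show ?thesis using x by simp
    qed
    have "net_out E g u \<le> 0" unfolding eq by (rule sum_nonpos, rule nonpos) auto
    then show False using Suc.prems(3) by simp
  qed
  from rtranclp_imp_arc_path[OF this] obtain ps where ps: "arc_path (\<lambda>x e y. e \<in> E \<and> ends G e = {x, y} \<and> g e x = 1) u ps v"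
    "distinct (u # map snd ps)" by blast
  define E' where "E' = E - fst ` set ps"
  have nth: "map fst ps ! i \<in> E \<and>
      ends G (map fst ps ! i) = {(u # map snd ps) ! i, (u # map snd ps) ! Suc i}"
    if "i < length ps" for i using arc_path_nth(2)[OF ps(1) that] by blast
  have sub: "fst ` set ps \<subseteq> E"
  proof
    fix e assume "e \<in> fst ` set ps"
    then obtain i where "i < length ps" "e = map fst ps ! i" by (metis in_set_conv_nth length_map set_map)
    then show "e \<in> E" using nth by simp
  qed
  have finE: "finite E" using G Suc.prems(1) by (auto simp: multigraph_def finite_subset)
  have net': "net_out E' g z = net_out E g z - (of_bool (z = u) - of_bool (z = v))" for z
    using net_out_arc_path[OF Suc.prems(2) ps, of z] sub finE
    by (simp add: net_out_def E'_def sum_diff)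
  have flow': "unit_flow G E' g" using Suc.prems(2) by (auto simp: unit_flow_def E'_def)
  have sub': "E' \<subseteq> edges G" using Suc.prems(1) by (auto simp: E'_def)
  have val': "net_out E' g u = int j" using net' Suc.prems(3) uv by simp
  have "\<forall>z\<in>vertices G. z \<noteq> u \<longrightarrow> z \<noteq> v \<longrightarrow> net_out E' g z = 0"
    using net' Suc.prems(4) by simp
  from Suc.IH[OF sub' flow' val' this] obtain p es where
    p: "\<forall>i<j. path_between G u (p i) (es i) v \<and> set (es i) \<subseteq> E'"
    and disj: "\<forall>i<j. \<forall>i'<j. i \<noteq> i' \<longrightarrow> set (es i) \<inter> set (es i') = {}"
    by (elim exE conjE)
  have "set (u # map snd ps) \<subseteq> vertices G"
  proof
    fix x assume "x \<in> set (u # map snd ps)"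
    then obtain i where i: "i < Suc (length ps)" "x = (u # map snd ps) ! i"
      by (metis in_set_conv_nth length_Cons length_map)
    show "x \<in> vertices G"
    proof (cases i)
      case 0
      then show ?thesis using i uv by simp
    next
      case (Suc i')
      then have "x \<in> ends G (map fst ps ! i')" "map fst ps ! i' \<in> E" using i nth[of i'] by auto
      then show ?thesis using G Suc.prems(1) unfolding multigraph_def by blast
    qed
  qed
  then have path: "path_between G u (u # map snd ps) (map fst ps) v"
    using ps(2) arc_path_nth(1)[OF ps(1)] nth Suc.prems(1)
    by (auto simp: path_between_def)
  let ?p = "p(j := u # map snd ps)" and ?es = "es(j := map fst ps)"
  have old: "set (es i) \<inter> fst ` set ps = {}" if "i < j" for i
    using p that by (auto simp: E'_def)
  have "set (?es i) \<inter> set (?es i') = {}" if "i < Suc j" "i' < Suc j" "i \<noteq> i'" for i i'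
    using that disj[rule_format, of i i'] old[of i] old[of i']
    by (cases "i = j"; cases "i' = j") (auto simp: less_Suc_eq Int_commute)
  moreover have "path_between G u (?p i) (?es i) v \<and> set (?es i) \<subseteq> E" if "i < Suc j" for i
    using that p path sub by (auto simp: E'_def less_Suc_eq)
  ultimately show ?case by (intro exI[of _ ?p] exI[of _ ?es]) simp
qed

lemma menger_edge_disjoint_paths:
  assumes "multigraph G" and "u \<in> vertices G" "v \<in> vertices G" "u \<noteq> v"
    and "\<And>X. X \<subseteq> vertices G \<Longrightarrow> u \<in> X \<Longrightarrow> v \<notin> X \<Longrightarrow> k \<le> card (cut_edges G X)"
  shows "edge_disjoint_paths G k u v"
proof -
  obtain g where "unit_flow G (edges G) g" "net_out (edges G) g u = int k"
    "\<forall>z\<in>vertices G. z \<noteq> u \<longrightarrow> z \<noteq> v \<longrightarrow> net_out (edges G) g z = 0"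
    using exists_unit_flow[OF assms, of k] by blast
  from unit_flow_decompose[OF assms(1-4) subset_refl this] obtain p es where
    "\<forall>i<k. path_between G u (p i) (es i) v \<and> set (es i) \<subseteq> edges G"
    "\<forall>i<k. \<forall>j<k. i \<noteq> j \<longrightarrow> set (es i) \<inter> set (es j) = {}" by (elim exE conjE)
  then show ?thesis
    unfolding edge_disjoint_paths_def by (intro exI[of _ p] exI[of _ es]) simp
qed

lemma path_between_crosses_cut:
  assumes p: "path_between G u p es v" and "u \<in> X" "v \<notin> X"
  shows "set es \<inter> cut_edges G X \<noteq> {}"
proof -
  have len: "length p = Suc (length es)" and d: "distinct p" and "hd p = u" "last p = v"
    using p by (auto simp: path_between_def)
  then have "p ! 0 \<in> X" "p ! length es \<notin> X"
    using assms hd_conv_nth[of p] last_conv_nth[of p] by force+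
  then obtain i where i: "i < length es" "p ! i \<in> X" "p ! Suc i \<notin> X"
    using ex_least_nat_less[of "\<lambda>i. p ! i \<notin> X" "length es"] by blast
  then have e: "es ! i \<in> edges G" "ends G (es ! i) = {p ! i, p ! Suc i}"
    using p by (auto simp: path_between_def)
  then have "ends G (es ! i) \<inter> X = {p ! i}" using i by auto
  then have "es ! i \<in> set es \<inter> cut_edges G X" using i e by (simp add: cut_edges_def)
  then show ?thesis by blast
qed

lemma edge_disjoint_paths_le_cut:
  assumes "finite (edges G)" and "edge_disjoint_paths G k u v" "u \<in> X" "v \<notin> X"
  shows "k \<le> card (cut_edges G X)"
proof -
  from assms(2) obtain p es where p: "\<forall>i<k. path_between G u (p i) (es i) v"
    and disj: "\<forall>i<k. \<forall>j<k. i \<noteq> j \<longrightarrow> set (es i) \<inter> set (es j) = {}"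
    unfolding edge_disjoint_paths_def by (elim exE conjE)
  have "\<exists>e. e \<in> set (es i) \<inter> cut_edges G X" if "i < k" for i
    using path_between_crosses_cut[OF p[rule_format, OF that] assms(3,4)] by blast
  then obtain c where c: "\<And>i. i < k \<Longrightarrow> c i \<in> set (es i) \<inter> cut_edges G X" by metis
  have "inj_on c {..<k}" using c disj by (intro inj_onI) (metis IntD1 disjoint_iff lessThan_iff)
  moreover have "c ` {..<k} \<subseteq> cut_edges G X" using c by auto
  moreover have "finite (cut_edges G X)" using assms(1) by (simp add: cut_edges_def)
  ultimately show ?thesis using card_inj_on_le[of c "{..<k}" "cut_edges G X"] by simp
qed

section \<open>Cuts and liftable pairs\<close>

lemma adjacent_commute: "adjacent G u v \<longleftrightarrow> adjacent G v u"
  by (simp add: adjacent_def insert_commute)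

lemma vertices_simple_graph [simp]: "vertices (simple_graph V R) = V"
  by (simp add: simple_graph_def)

lemma adjacent_simple_graph:
  "adjacent (simple_graph V R) x y \<longleftrightarrow> x \<in> V \<and> y \<in> V \<and> x \<noteq> y \<and> (R x y \<or> R y x)"
  by (auto simp: adjacent_def simple_graph_def doubleton_eq_iff)

lemma adjacent_complement_graph:
  "adjacent (complement_graph H) x y \<longleftrightarrow>
    x \<in> vertices H \<and> y \<in> vertices H \<and> x \<noteq> y \<and> \<not> adjacent H x y"
  unfolding complement_graph_def adjacent_simple_graph by (auto simp: adjacent_commute)

lemma path_between_imp_rtranclp:
  assumes "path_between G u p es v"
  shows "(adjacent G)\<^sup>*\<^sup>* u v"
proof -
  have len: "length p = Suc (length es)" and "hd p = u" "last p = v"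
    and step: "\<And>i. i < length es \<Longrightarrow> adjacent G (p ! i) (p ! Suc i)"
    using assms by (auto simp: path_between_def adjacent_def)
  then have p: "p ! 0 = u" "p ! length es = v"
    using hd_conv_nth[of p] last_conv_nth[of p] by force+
  have "i \<le> length es \<Longrightarrow> (adjacent G)\<^sup>*\<^sup>* u (p ! i)" for i
  proof (induction i)
    case 0
    then show ?case using p by simp
  next
    case (Suc i)
    then show ?case using step[of i] by (meson Suc_leD Suc_le_lessD rtranclp.rtrancl_into_rtrancl)
  qed
  then show ?thesis using p(2) by auto
qed

lemma connected_graph_rtranclp:
  "connected_graph G \<Longrightarrow> u \<in> vertices G \<Longrightarrow> v \<in> vertices G \<Longrightarrow> (adjacent G)\<^sup>*\<^sup>* u v"
  unfolding connected_graph_def using path_between_imp_rtranclp by metis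

lemma connected_graph_has_neighbour:
  assumes "connected_graph G" "u \<in> vertices G" "v \<in> vertices G" "u \<noteq> v"
  obtains w where "adjacent G u w"
  using connected_graph_rtranclp[OF assms(1-3)] assms(4) by (meson converse_rtranclpE)

lemma edges_between_commute: "edges_between G X Y = edges_between G Y X"
  unfolding edges_between_def by (metis (lifting) insert_commute)

section \<open>Edge counts between vertex sets and the cut function\<close>

locale rooted_multigraph =
  fixes G :: "('v, 'e) mgraph" and s :: 'v
  assumes mg: "multigraph G" and root: "s \<in> vertices G"
begin

abbreviation V where "V \<equiv> vertices G"
abbreviation W where "W \<equiv> vertices G - {s}"
abbreviation d where "d X \<equiv> card (cut_edges G X)"
abbreviation ee where "ee X Y \<equiv> card (edges_between G X Y)"

lemma finV: "finite V" and finE: "finite (edges G)"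
  using mg by (auto simp: multigraph_def)

lemma fin_between: "finite (edges_between G X Y)"
  using finE by (simp add: edges_between_def)

lemma ee_commute: "ee X Y = ee Y X"
  by (simp add: edges_between_commute)

lemma ee_Un_left:
  assumes "X \<inter> Y = {}" "Z \<inter> (X \<union> Y) = {}"
  shows "ee (X \<union> Y) Z = ee X Z + ee Y Z"
proof -
  have "edges_between G (X \<union> Y) Z = edges_between G X Z \<union> edges_between G Y Z"
    by (auto simp: edges_between_def)
  moreover have "edges_between G X Z \<inter> edges_between G Y Z = {}"
    using assms by (fastforce simp: edges_between_def doubleton_eq_iff)
  ultimately show ?thesis using fin_between by (simp add: card_Un_disjoint)
qed

lemma ee_Un_right:
  assumes "X \<inter> Y = {}" "Z \<inter> (X \<union> Y) = {}"
  shows "ee Z (X \<union> Y) = ee Z X + ee Z Y"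
  using ee_Un_left[OF assms] by (simp add: ee_commute)

lemma ee_mono: "X \<subseteq> X' \<Longrightarrow> Y \<subseteq> Y' \<Longrightarrow> ee X Y \<le> ee X' Y'"
  by (rule card_mono[OF fin_between]) (auto simp: edges_between_def)

lemma ee_empty [simp]: "ee {} Y = 0" "ee X {} = 0"
  by (auto simp: edges_between_def)

lemma in_cut_edges_iff:
  "e \<in> edges G \<Longrightarrow> ends G e = {x, y} \<Longrightarrow> x \<noteq> y \<Longrightarrow> e \<in> cut_edges G X \<longleftrightarrow> (x \<in> X) \<noteq> (y \<in> X)"
  by (simp add: cut_edges_def card_pair_Int_eq_1 del: One_nat_def)

lemma cut_edges_eq_between:
  assumes "X \<subseteq> V"
  shows "cut_edges G X = edges_between G X (V - X)"
proof (rule set_eqI)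
  fix e
  show "e \<in> cut_edges G X \<longleftrightarrow> e \<in> edges_between G X (V - X)"
  proof (cases "e \<in> edges G")
    case True
    then obtain x y where "ends G e = {x, y}" "x \<noteq> y" "x \<in> V" "y \<in> V"
      by (rule multigraph_ends_cases[OF mg])
    then show ?thesis using True in_cut_edges_iff[of e x y X]
      by (auto simp: edges_between_def doubleton_eq_iff)
  qed (simp add: cut_edges_def edges_between_def)
qed

lemma d_eq: "X \<subseteq> V \<Longrightarrow> d X = ee X (V - X)"
  by (simp add: cut_edges_eq_between)

lemma d_complement: "X \<subseteq> V \<Longrightarrow> d (V - X) = d X"
  using d_eq[of X] d_eq[of "V - X"] by (simp add: double_diff ee_commute)

lemma d_split:
  assumes "X \<union> Y \<union> Z = V" "X \<inter> Y = {}" "X \<inter> Z = {}" "Y \<inter> Z = {}"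
  shows "d X = ee X Y + ee X Z"
proof -
  have "V - X = Y \<union> Z" "X \<subseteq> V" using assms by auto
  then show ?thesis using d_eq[of X] ee_Un_right[of Y Z X] assms by auto
qed

lemma d_split3:
  assumes "X \<union> Y \<union> Z \<union> U = V" "X \<inter> Y = {}" "X \<inter> Z = {}" "X \<inter> U = {}"
    "Y \<inter> Z = {}" "Y \<inter> U = {}" "Z \<inter> U = {}"
  shows "d X = ee X Y + ee X Z + ee X U"
proof -
  have "d X = ee X (Y \<union> Z) + ee X U" using assms by (intro d_split) auto
  then show ?thesis using ee_Un_right[of Y Z X] assms by auto
qed

lemma d_Un:
  assumes "X \<subseteq> V" "Y \<subseteq> V" "X \<inter> Y = {}"
  shows "d X + d Y = d (X \<union> Y) + 2 * ee X Y"
proof -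
  let ?Z = "V - (X \<union> Y)"
  have "d X = ee X Y + ee X ?Z" "d Y = ee Y X + ee Y ?Z"
    using assms by (intro d_split; auto)+
  moreover have "d (X \<union> Y) = ee X ?Z + ee Y ?Z"
    using assms d_eq[of "X \<union> Y"] ee_Un_left[of X Y ?Z] by auto
  ultimately show ?thesis using ee_commute[of X Y] by simp
qed

text \<open>The four regions determined by \<open>A\<close> and \<open>B\<close> have six edge
  counts between them, and every cut is a sum of some of these. Later submodularity-type arguments
  thereby become linear arithmetic.\<close>

lemma cut_two_sets:
  assumes "A \<subseteq> V" "B \<subseteq> V"
  defines "P \<equiv> A - B" and "Q \<equiv> A \<inter> B" and "R \<equiv> B - A" and "Z \<equiv> V - (A \<union> B)"
  shows "d A = ee P R + ee P Z + ee Q R + ee Q Z"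
    and "d B = ee P R + ee R Z + ee Q P + ee Q Z"
    and "d (A \<inter> B) = ee Q P + ee Q R + ee Q Z"
    and "d (A \<union> B) = ee P Z + ee Q Z + ee R Z"
    and "d (A - B) = ee Q P + ee P R + ee P Z"
    and "d (B - A) = ee P R + ee Q R + ee R Z"
proof -
  have 1: "d P = ee P Q + ee P R + ee P Z" "d R = ee R P + ee R Q + ee R Z"
    and 2: "d Q = ee Q P + ee Q R + ee Q Z" "d Z = ee Z P + ee Z Q + ee Z R"
    using assms by (intro d_split3; auto)+
  have c: "ee P Q = ee Q P" "ee R P = ee P R" "ee R Q = ee Q R" "ee Z P = ee P Z"
    "ee Z Q = ee Q Z" "ee Z R = ee R Z" by (simp_all add: ee_commute)
  have "P \<union> Q = A" "R \<union> Q = B" "P \<inter> Q = {}" "R \<inter> Q = {}" "P \<subseteq> V" "Q \<subseteq> V" "R \<subseteq> V"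
    using assms by auto
  then have "d P + d Q = d A + 2 * ee P Q" "d R + d Q = d B + 2 * ee R Q"
    using d_Un[of P Q] d_Un[of R Q] by simp_all
  moreover have "d (A \<union> B) = d Z" using d_complement[of "A \<union> B"] assms by simp
  ultimately show "d A = ee P R + ee P Z + ee Q R + ee Q Z"
    "d B = ee P R + ee R Z + ee Q P + ee Q Z" "d (A \<union> B) = ee P Z + ee Q Z + ee R Z"
    "d (A \<inter> B) = ee Q P + ee Q R + ee Q Z"
    "d (A - B) = ee Q P + ee P R + ee P Z" "d (B - A) = ee P R + ee Q R + ee R Z"
    using 1 2 c unfolding P_def[symmetric] Q_def[symmetric] R_def[symmetric] by linarith+
qed

text \<open>Looplessness makes the \<open>THE\<close> in \<open>other_end\<close> well
  defined.\<close>

lemma ends_other_end: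
  assumes "e \<in> edges_at G s"
  shows "ends G e = {s, other_end G s e}" and "other_end G s e \<in> W"
proof -
  from assms have e: "e \<in> edges G" "s \<in> ends G e" by (auto simp: edges_at_def)
  then obtain x y where "ends G e = {x, y}" "x \<noteq> y" "x \<in> V" "y \<in> V"
    by (rule_tac multigraph_ends_cases[OF mg])
  then obtain v where v: "ends G e = {s, v}" "v \<in> W" using e by fastforce
  moreover have "other_end G s e = v"
    unfolding other_end_def using v by (auto simp: doubleton_eq_iff)
  ultimately show "ends G e = {s, other_end G s e}" "other_end G s e \<in> W" by auto
qed

lemma edges_between_root:
  assumes "X \<subseteq> W"
  shows "edges_between G X {s} = {e \<in> edges_at G s. other_end G s e \<in> X}"
proof (rule set_eqI)
  fix e
  show "e \<in> edges_between G X {s} \<longleftrightarrow> e \<in> {e \<in> edges_at G s. other_end G s e \<in> X}"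
  proof (cases "e \<in> edges_at G s")
    case True
    then show ?thesis using ends_other_end[OF True] assms
      by (auto simp: edges_between_def edges_at_def doubleton_eq_iff)
  qed (auto simp: edges_between_def edges_at_def)
qed

text \<open>The new edge crosses \<open>X\<close> exactly when one of \<open>e\<close>,
  \<open>f\<close> does but not the other, so the cut changes only if both ends lie in
  \<open>X\<close>. The loss of 2 is stated additively because subtraction on \<open>nat\<close>
  truncates.\<close>

lemma card_cut_lift_edges:
  assumes e: "e \<in> edges_at G s" and f: "f \<in> edges_at G s" and "e \<noteq> f" and X: "X \<subseteq> W"
  shows "card (cut_edges (lift_edges G s e f) X) +
      (if other_end G s e \<in> X \<and> other_end G s f \<in> X then 2 else 0) = d X"
proof -
  define v w where "v = other_end G s e" and "w = other_end G s f"
  define H where "H = lift_edges G s e f"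
  define C where "C = cut_edges G X - {e, f}"
  have E: "e \<in> edges G" "f \<in> edges G" using e f by (auto simp: edges_at_def)
  have ends: "ends G e = {s, v}" "ends G f = {s, w}" "v \<noteq> s" "w \<noteq> s" "s \<notin> X"
    using ends_other_end[OF e] ends_other_end[OF f] X by (auto simp: v_def w_def)
  have ef: "e \<in> cut_edges G X \<longleftrightarrow> v \<in> X" "f \<in> cut_edges G X \<longleftrightarrow> w \<in> X"
    using in_cut_edges_iff[of e s v X] in_cut_edges_iff[of f s w X] E ends by auto
  have finC: "finite C" and notC: "e \<notin> C" "f \<notin> C"
    using finE by (auto simp: C_def cut_edges_def)
  have cG: "cut_edges G X = C \<union> (if v \<in> X then {e} else {}) \<union> (if w \<in> X then {f} else {})"
    using ef by (auto simp: C_def)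
  \<comment> \<open>In the lifted graph the name \<open>e\<close> denotes the new edge; if
    \<open>v = w\<close> there is none, and the condition is false.\<close>
  have cH: "cut_edges H X = C \<union> (if (v \<in> X) \<noteq> (w \<in> X) then {e} else {})"
  proof (cases "v = w")
    case True
    then have "H = G\<lparr>edges := edges G - {e, f}\<rparr>"
      by (simp add: H_def lift_edges_def v_def w_def)
    then show ?thesis using True by (auto simp: C_def cut_edges_def)
  next
    case False
    then have H: "H = G\<lparr>edges := edges G - {f}, ends := (ends G)(e := {v, w})\<rparr>"
      by (simp add: H_def lift_edges_def v_def w_def Let_def)
    have "e \<in> cut_edges H X \<longleftrightarrow> (v \<in> X) \<noteq> (w \<in> X)"
      using card_pair_Int_eq_1[OF False, of X] E \<open>e \<noteq> f\<close> by (simp add: H cut_edges_def)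
    moreover have "cut_edges H X - {e} = C" by (auto simp: H C_def cut_edges_def)
    ultimately show ?thesis by auto
  qed
  show ?thesis
    using finC notC \<open>e \<noteq> f\<close> unfolding H_def[symmetric] v_def[symmetric] w_def[symmetric] cG cH
    by (cases "v \<in> X"; cases "w \<in> X") simp_all
qed

lemma multigraph_lift_edges:
  assumes e: "e \<in> edges_at G s" and f: "f \<in> edges_at G s"
  shows "multigraph (lift_edges G s e f)" "vertices (lift_edges G s e f) = V"
  using mg ends_other_end[OF e] ends_other_end[OF f]
  by (auto simp: multigraph_def lift_edges_def Let_def)

end

section \<open>Liftable pairs and dangerous sets\<close>

locale sk_connected_graph = rooted_multigraph +
  fixes k :: nat
  assumes sk: "sk_edge_connected G s k"
begin

lemma d_ge_k:
  assumes "X \<subseteq> W" "X \<noteq> {}" "X \<noteq> W"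
  shows "k \<le> d X"
proof -
  obtain u v where uv: "u \<in> X" "v \<in> W" "v \<notin> X" using assms by blast
  then have "u \<in> W" "u \<noteq> v" using assms(1) by auto
  then have "edge_disjoint_paths G k u v"
    using sk uv(2) by (simp add: sk_edge_connected_def)
  then show ?thesis using edge_disjoint_paths_le_cut[OF finE _ uv(1,3)] by simp
qed

lemma dangerous_iff:
  "dangerous G s k A \<longleftrightarrow> A \<subseteq> W \<and> A \<noteq> {} \<and> A \<noteq> W \<and> d A \<le> k + 1"
  unfolding dangerous_def by blast

text \<open>By Menger only cuts matter. Lifting brings a cut below \<open>k\<close> only if
  \<open>X\<close> contains both ends and \<open>d X \<le> k + 1\<close>, which makes
  \<open>X\<close> dangerous.\<close>

lemma liftable_iff:
  assumes e: "e \<in> edges_at G s" and f: "f \<in> edges_at G s" and "e \<noteq> f"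
  shows "liftable G s k e f \<longleftrightarrow>
    \<not> (\<exists>A. dangerous G s k A \<and> other_end G s e \<in> A \<and> other_end G s f \<in> A)"
proof -
  define H where "H = lift_edges G s e f"
  have H: "multigraph H" "vertices H = V"
    using multigraph_lift_edges[OF e f] by (simp_all add: H_def)
  interpret H: rooted_multigraph H s using H root by unfold_locales auto
  have cut: "card (cut_edges H X) +
      (if other_end G s e \<in> X \<and> other_end G s f \<in> X then 2 else 0) = d X" if "X \<subseteq> W" for X
    unfolding H_def using card_cut_lift_edges[OF e f \<open>e \<noteq> f\<close> that] .
  show ?thesis unfolding liftable_def H_def[symmetric]
  proof
    assume skH: "sk_edge_connected H s k"
    show "\<not> (\<exists>A. dangerous G s k A \<and> other_end G s e \<in> A \<and> other_end G s f \<in> A)"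
    proof
      assume "\<exists>A. dangerous G s k A \<and> other_end G s e \<in> A \<and> other_end G s f \<in> A"
      then obtain A where A: "dangerous G s k A" "other_end G s e \<in> A" "other_end G s f \<in> A"
        by blast
      interpret Hc: sk_connected_graph H s k using skH by unfold_locales
      have "k \<le> card (cut_edges H A)" using A(1) H(2) unfolding dangerous_iff
        by (intro Hc.d_ge_k) auto
      then show False using cut[of A] A by (simp add: dangerous_iff)
    qed
  next
    assume no: "\<not> (\<exists>A. dangerous G s k A \<and> other_end G s e \<in> A \<and> other_end G s f \<in> A)"
    have ge: "k \<le> card (cut_edges H X)" if X: "X \<subseteq> W" "X \<noteq> {}" "X \<noteq> W" for X
    proof (rule ccontr)
      assume "\<not> k \<le> card (cut_edges H X)"
      then have "other_end G s e \<in> X \<and> other_end G s f \<in> X" "d X \<le> k + 1"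
        using cut[OF X(1)] d_ge_k[OF X] by (auto split: if_splits)
      then show False using no X by (auto simp: dangerous_iff)
    qed
    have "edge_disjoint_paths H k u v" if uv: "u \<in> W" "v \<in> W" "u \<noteq> v" for u v
    proof (rule menger_edge_disjoint_paths[OF H(1)])
      fix X assume X: "X \<subseteq> vertices H" "u \<in> X" "v \<notin> X"
      show "k \<le> card (cut_edges H X)"
      proof (cases "s \<in> X")
        case False
        then show ?thesis using X uv H(2) by (intro ge) auto
      next
        \<comment> \<open>The bound \<open>ge\<close> concerns sets avoiding \<open>s\<close>; the
          complement of \<open>X\<close> avoids \<open>s\<close> and has the same cut.\<close>
        case True
        then have "k \<le> card (cut_edges H (V - X))" using X uv H(2) by (intro ge) auto
        then show ?thesis using H.d_complement[of X] X H(2) by simp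
      qed
    qed (use uv H in auto)
    then show "sk_edge_connected H s k"
      using sk H(2) by (simp add: sk_edge_connected_def)
  qed
qed

abbreviation "L \<equiv> lifting_graph G s k"

lemma vertices_L [simp]: "vertices L = edges_at G s"
  by (simp add: lifting_graph_def)

lemma adjacent_L:
  "adjacent L e f \<longleftrightarrow> e \<in> edges_at G s \<and> f \<in> edges_at G s \<and> e \<noteq> f \<and>
    \<not> (\<exists>A. dangerous G s k A \<and> other_end G s e \<in> A \<and> other_end G s f \<in> A)"
  unfolding lifting_graph_def adjacent_simple_graph using liftable_iff by metis

end

section \<open>Crossing dangerous sets\<close>

context rooted_multigraph begin

abbreviation nb where "nb X \<equiv> ee X {s}"

definition root_edges :: "'v set \<Rightarrow> 'e set" where
  "root_edges X = {e \<in> edges_at G s. other_end G s e \<in> X}"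

lemma nb_eq: "X \<subseteq> W \<Longrightarrow> nb X = card (root_edges X)"
  by (simp add: edges_between_root root_edges_def)

lemma finite_edges_at [simp]: "finite (edges_at G s)"
  using finE by (simp add: edges_at_def)

lemma finite_root_edges [simp]: "finite (root_edges X)"
  by (simp add: root_edges_def)

lemma root_edges_mono: "X \<subseteq> Y \<Longrightarrow> root_edges X \<subseteq> root_edges Y"
  by (auto simp: root_edges_def)

lemma root_edges_W: "root_edges W = edges_at G s"
  using ends_other_end(2) by (auto simp: root_edges_def)

lemma nb_W: "nb W = degree G s"
  by (simp add: nb_eq root_edges_W degree_def)

lemma nb_Un: "X \<subseteq> W \<Longrightarrow> Y \<subseteq> W \<Longrightarrow> nb (X \<union> Y) + nb (X \<inter> Y) = nb X + nb Y"
proof -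
  assume X: "X \<subseteq> W" "Y \<subseteq> W"
  have "card (root_edges X) + card (root_edges Y) =
      card (root_edges X \<union> root_edges Y) + card (root_edges X \<inter> root_edges Y)"
    by (intro card_Un_Int) auto
  moreover have "root_edges X \<union> root_edges Y = root_edges (X \<union> Y)"
    "root_edges X \<inter> root_edges Y = root_edges (X \<inter> Y)" by (auto simp: root_edges_def)
  ultimately show ?thesis using X by (simp add: nb_eq le_infI1)
qed

lemma nb_ge_1: "X \<subseteq> W \<Longrightarrow> e \<in> root_edges X \<Longrightarrow> 1 \<le> nb X"
  using card_gt_0_iff[of "root_edges X"] by (auto simp: nb_eq)

lemma ee_outside:
  assumes "X \<subseteq> Y" "Y \<subseteq> W"
  shows "ee X (V - Y) = nb X + ee X (W - Y)"
proof -
  have "V - Y = {s} \<union> (W - Y)" using assms root by auto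
  then show ?thesis using ee_Un_right[of "{s}" "W - Y" X] assms by auto
qed

end

context sk_connected_graph begin

abbreviation dng where "dng \<equiv> dangerous G s k"

lemma dngD: "dng A \<Longrightarrow> A \<subseteq> W" "dng A \<Longrightarrow> A \<noteq> {}" "dng A \<Longrightarrow> A \<noteq> W" "dng A \<Longrightarrow> d A \<le> k + 1"
  by (auto simp: dangerous_iff)

text \<open>In the identity for \<open>d A + d B\<close> the left side is at most
  \<open>2 * k + 2\<close>. On the right the two differences contribute at least \<open>k\<close>
  each and the edge to \<open>s\<close> at least 2, so equality holds throughout.\<close>

lemma crossing_dangerous:
  assumes A: "dng A" and B: "dng B" and "\<not> A \<subseteq> B" "\<not> B \<subseteq> A" and "1 \<le> nb (A \<inter> B)"
  shows "d A = k + 1" "d B = k + 1" "d (A - B) = k" "d (B - A) = k"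
    "nb (A \<inter> B) = 1" "ee (A \<inter> B) (W - (A \<union> B)) = 0"
proof -
  note dA = dngD[OF A] and dB = dngD[OF B]
  have sub: "A \<subseteq> V" "B \<subseteq> V" using dA(1) dB(1) by auto
  have "k \<le> d (A - B)" "k \<le> d (B - A)" using assms dA dB by (intro d_ge_k; blast)+
  moreover have "ee (A \<inter> B) (V - (A \<union> B)) = nb (A \<inter> B) + ee (A \<inter> B) (W - (A \<union> B))"
    using dA(1) dB(1) by (intro ee_outside) auto
  ultimately show "d A = k + 1" "d B = k + 1" "d (A - B) = k" "d (B - A) = k"
    "nb (A \<inter> B) = 1" "ee (A \<inter> B) (W - (A \<union> B)) = 0"
    using cut_two_sets[OF sub] dA(4) dB(4) assms(5) by linarith+
qed

lemma dangerous_comparable: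
  assumes "dng A" "dng B" "2 \<le> nb (A \<inter> B)"
  shows "A \<subseteq> B \<or> B \<subseteq> A"
  using crossing_dangerous(5)[OF assms(1,2)] assms(3) by fastforce

text \<open>
  This is the position of the dangerous sets of two distinct intersecting maximal independent sets:
  the union is not \<open>W\<close> because the lifting graph is connected, and not dangerous by maximality.
\<close>

definition linked :: "'a set \<Rightarrow> 'a set \<Rightarrow> bool" where
  "linked A B \<longleftrightarrow> dng A \<and> dng B \<and> \<not> A \<subseteq> B \<and> \<not> B \<subseteq> A \<and> 1 \<le> nb (A \<inter> B) \<and>
     A \<union> B \<noteq> W \<and> \<not> dng (A \<union> B)"

lemma linked_commute: "linked A B \<longleftrightarrow> linked B A"
  unfolding linked_def by (auto simp: Int_commute Un_commute)

text \<open>Since \<open>d A + d B = 2 * k + 2\<close>, \<open>d (A \<inter> B) \<ge> k\<close> and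
  \<open>d (A \<union> B) \<ge> k + 2\<close>, submodularity is tight and no edge joins the two
  differences. Then \<open>d A = d (A - B) + 1\<close> forces the \<open>k - 1\<close> edges from
  \<open>A \<inter> B\<close> to the differences to split evenly.\<close>

lemma linkedD:
  assumes "linked A B"
  shows "odd k" "d A = k + 1" "d (A \<inter> B) = k" "d (A - B) = k"
    "nb (A \<inter> B) = 1" "ee (A \<inter> B) (W - (A \<union> B)) = 0"
    "ee (A \<inter> B) (A - B) = (k - 1) div 2" "ee (A \<inter> B) (B - A) = (k - 1) div 2"
    "ee (A - B) (B - A) = 0"
proof -
  have A: "dng A" and B: "dng B" and inc: "\<not> A \<subseteq> B" "\<not> B \<subseteq> A" and nb: "1 \<le> nb (A \<inter> B)"
    and un: "A \<union> B \<noteq> W" "\<not> dng (A \<union> B)" using assms by (auto simp: linked_def)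
  note dA = dngD[OF A] and dB = dngD[OF B]
  note c = crossing_dangerous[OF A B inc nb]
  have sub: "A \<subseteq> V" "B \<subseteq> V" using dA(1) dB(1) by auto
  have Z: "ee (A \<inter> B) (V - (A \<union> B)) = 1"
    using dA(1) dB(1) ee_outside[of "A \<inter> B" "A \<union> B"] c by auto
  have "A \<inter> B \<noteq> {}" using nb by auto
  then have k1: "k \<le> d (A \<inter> B)" using dA dB by (intro d_ge_k; blast)
  have k2: "k + 2 \<le> d (A \<union> B)" using un dA dB by (auto simp: dangerous_iff)
  note eqs = cut_two_sets[OF sub]
  show "d A = k + 1" "d (A - B) = k" "nb (A \<inter> B) = 1" "ee (A \<inter> B) (W - (A \<union> B)) = 0"
    using c by auto
  have k3: "d (A \<inter> B) = k" and z: "ee (A - B) (B - A) = 0"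
    using eqs c k1 k2 by linarith+
  have a: "k = 2 * ee (A \<inter> B) (A - B) + 1" "k = 2 * ee (A \<inter> B) (B - A) + 1"
    using eqs c k3 z Z by linarith+
  from a(1) show "odd k" by (metis even_Suc even_mult_iff even_numeral Suc_eq_plus1)
  from a show "ee (A \<inter> B) (A - B) = (k - 1) div 2" "ee (A \<inter> B) (B - A) = (k - 1) div 2"
    by linarith+
  show "d (A \<inter> B) = k" "ee (A - B) (B - A) = 0" using k3 z by auto
qed

text \<open>If \<open>X\<close> and \<open>Y\<close> crossed, \<open>X \<inter> Y\<close> would send \<open>k / 2\<close> edges to each of \<open>X - Y\<close> and \<open>Y - X\<close>.\<close>

lemma tight_sets_comparable:
  assumes "odd k" and X: "X \<subseteq> W" "d X = k" and Y: "Y \<subseteq> W" "d Y = k"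
    and "X \<inter> Y \<noteq> {}" "X \<union> Y \<noteq> W"
  shows "X \<subseteq> Y \<or> Y \<subseteq> X"
proof (rule ccontr)
  assume n: "\<not> ?thesis"
  have sub: "X \<subseteq> V" "Y \<subseteq> V" using X Y by auto
  have "k \<le> d (X - Y)" "k \<le> d (Y - X)" "k \<le> d (X \<inter> Y)" "k \<le> d (X \<union> Y)"
    using n assms by (intro d_ge_k; blast)+
  then have "k = 2 * ee (X \<inter> Y) (X - Y)" using cut_two_sets[OF sub] X Y by linarith
  then show False using \<open>odd k\<close> by (metis dvd_triv_left)
qed

text \<open>Each of the two intersections sends only \<open>r\<close> of its
  \<open>2 * r + 1\<close> edges into the rest of \<open>A\<close>, so together they send
  \<open>k + 1\<close> edges out of \<open>A\<close>, which is all of \<open>d A\<close>. The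
  remainder \<open>U\<close> then has at most \<open>2 * r < k\<close> edges in its cut and must be
  empty.\<close>

lemma linked_twice:
  assumes AB: "linked A B" and AC: "linked A C" and disj: "A \<inter> B \<inter> C = {}"
  shows "A = (A \<inter> B) \<union> (A \<inter> C)" "ee (A \<inter> B) (A \<inter> C) = (k - 1) div 2" "nb A = 2"
proof -
  define r where "r = (k - 1) div 2"
  have k: "k = 2 * r + 1" using linkedD(1)[OF AB] by (auto simp: r_def elim: oddE)
  have A: "dng A" using AB by (simp add: linked_def)
  then have sub: "A \<subseteq> W" "A \<subseteq> V" using dngD(1) by auto
  define X where "X = A \<inter> B" define Y where "Y = A \<inter> C"
  define U where "U = A - B - C" define Z where "Z = V - A"
  have X: "d X = k" "ee X (A - B) = r" and Y: "d Y = k" "ee Y (A - C) = r"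
    using linkedD[OF AB] linkedD[OF AC] by (simp_all add: X_def Y_def r_def)
  have part: "A = X \<union> Y \<union> U" "X \<inter> Y = {}" "X \<inter> U = {}" "Y \<inter> U = {}"
    "X \<inter> Z = {}" "Y \<inter> Z = {}" "U \<inter> Z = {}" "X \<union> Y \<union> U \<union> Z = V"
    using disj sub unfolding X_def Y_def U_def Z_def by blast+
  have XY: "ee X Y + ee X U = r"
  proof -
    have "A - B = Y \<union> U" using part(1,2,3) unfolding X_def by blast
    then show ?thesis using X(2) ee_Un_right[of Y U X] part(2-4) by (simp add: Int_Un_distrib)
  qed
  have YX: "ee Y X + ee Y U = r"
  proof -
    have "A - C = X \<union> U" using part(1,2,4) unfolding Y_def by blast
    then show ?thesis using Y(2) ee_Un_right[of X U Y] part(2-4) by (simp add: Int_Un_distrib Int_commute)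
  qed
  have dX: "d X = ee X Y + ee X U + ee X Z" using part by (intro d_split3) auto
  have dY: "d Y = ee Y X + ee Y U + ee Y Z" using part by (intro d_split3) auto
  have dU: "d U = ee U X + ee U Y + ee U Z" using part by (intro d_split3) auto
  have "d A = ee X Z + ee Y Z + ee U Z"
  proof -
    have "d A = ee A Z" using d_eq[OF sub(2)] Z_def by simp
    also have "\<dots> = ee (X \<union> Y) Z + ee U Z"
      unfolding part(1) using part by (intro ee_Un_left) auto
    also have "ee (X \<union> Y) Z = ee X Z + ee Y Z" using part by (intro ee_Un_left) auto
    finally show ?thesis .
  qed
  then have UZ: "ee U Z = 0" using XY YX dX dY X Y k linkedD(2)[OF AB] by linarith
  have "U = {}"
  proof (rule ccontr)
    assume "U \<noteq> {}"
    moreover have "U \<noteq> W" "U \<subseteq> W" using dngD[OF A] U_def by auto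
    ultimately have "k \<le> d U" by (intro d_ge_k)
    then show False using dU UZ XY YX k ee_commute[of U X] ee_commute[of U Y] by linarith
  qed
  then have AXY: "A = X \<union> Y" using part(1) by simp
  then show "A = (A \<inter> B) \<union> (A \<inter> C)" unfolding X_def Y_def .
  show "ee (A \<inter> B) (A \<inter> C) = (k - 1) div 2"
    using XY \<open>U = {}\<close> unfolding X_def Y_def r_def by simp
  have "nb A = nb X + nb Y" unfolding AXY using part sub by (intro ee_Un_left) auto
  then show "nb A = 2" using linkedD(5)[OF AB] linkedD(5)[OF AC] by (simp add: X_def Y_def)
qed

text \<open>Edges between \<open>A\<close> and \<open>W - A\<close> count in both cuts, so
  \<open>nb A\<close> exceeds \<open>nb (W - A)\<close> by at most
  \<open>(k + 1) - k = 1\<close>.\<close>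

lemma dangerous_nb_le:
  assumes "dng A"
  shows "2 * nb A \<le> degree G s + 1"
proof -
  note A = dngD[OF assms]
  have nb: "nb A + nb (W - A) = degree G s"
  proof -
    have "A \<union> (W - A) = W" "A \<inter> (W - A) = {}" using A by auto
    then show ?thesis using nb_Un[of A "W - A"] nb_W A(1) by simp
  qed
  have "d A = nb A + ee A (W - A)" using A(1) d_eq[of A] ee_outside[of A A] by auto
  moreover have "d (W - A) = nb (W - A) + ee (W - A) A"
  proof -
    have "W - (W - A) = A" using A by auto
    then show ?thesis using d_eq[of "W - A"] ee_outside[of "W - A" "W - A"] by auto
  qed
  moreover have "k \<le> d (W - A)" using A by (intro d_ge_k) auto
  ultimately show ?thesis using A(4) nb ee_commute[of A "W - A"] by linarith
qed

end

section \<open>Independent sets lie in dangerous sets\<close>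

locale lifting_setting = sk_connected_graph +
  assumes k_ge_2: "2 \<le> k" and deg: "4 < degree G s"
begin

text \<open>The points \<open>v\<close> and \<open>w\<close> make the tight sets
  \<open>C \<inter> A\<close> and \<open>C \<inter> B\<close> incomparable, hence disjoint, and
  \<open>linked_twice\<close> applies to \<open>C\<close>. The edges it finds inside
  \<open>C\<close> run between \<open>A - B\<close> and \<open>B - A\<close>.\<close>

lemma linked_triangle:
  assumes AC: "linked A C" and BC: "linked B C"
    and v: "v \<in> A \<inter> C - B" and w: "w \<in> B \<inter> C - A"
  shows "nb C = 2" "(k - 1) div 2 \<le> ee (A - B) (B - A)"
proof -
  have CA: "linked C A" and CB: "linked C B" using AC BC linked_commute by auto
  have sub: "A \<subseteq> W" "B \<subseteq> W" "C \<subseteq> W" "C \<noteq> W" using AC BC by (auto simp: linked_def dangerous_iff)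
  have disj: "C \<inter> A \<inter> B = {}"
  proof (rule ccontr)
    assume "C \<inter> A \<inter> B \<noteq> {}"
    moreover have "C \<inter> A \<union> C \<inter> B \<noteq> W" using sub by blast
    ultimately have "C \<inter> A \<subseteq> C \<inter> B \<or> C \<inter> B \<subseteq> C \<inter> A"
      using sub linkedD[OF CA] linkedD[OF CB] by (intro tight_sets_comparable) auto
    then show False using v w by auto
  qed
  show "nb C = 2" by (rule linked_twice(3)[OF CA CB disj])
  have "ee (C \<inter> A) (C \<inter> B) \<le> ee (A - B) (B - A)" using disj by (intro ee_mono) auto
  then show "(k - 1) div 2 \<le> ee (A - B) (B - A)" using linked_twice(2)[OF CA CB disj] by simp
qed

context
  fixes A B C v1 v2 v3
  assumes dng: "dng A" "dng B" "dng C"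
    and nb: "1 \<le> nb (A \<inter> B)" "1 \<le> nb (B \<inter> C)" "1 \<le> nb (A \<inter> C)"
    and v: "v1 \<in> A \<inter> C" "v2 \<in> A \<inter> B" "v3 \<in> B \<inter> C"
    and no: "\<And>X. dng X \<Longrightarrow> \<not> (v1 \<in> X \<and> v2 \<in> X \<and> v3 \<in> X)"
begin

text \<open>
  If \<open>A \<union> B = W\<close> then \<open>A\<close> and \<open>B\<close> have \<open>(deg s + 1) / 2 \<ge> 3\<close> edges to \<open>s\<close> each and \<open>C\<close> at most two.
  So \<open>C\<close> is linked to both, and the \<open>(k - 1) / 2\<close> edges inside \<open>C\<close> make \<open>d A\<close> too large.
\<close>

lemma no_triangle_cover: "A \<union> B \<noteq> W"
proof
  assume AB: "A \<union> B = W"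
  \<comment> \<open>Each of the three sets already contains two of the points, so by
    \<open>no\<close> it misses the third.\<close>
  have n: "v3 \<notin> A" "v1 \<notin> B" "v2 \<notin> C" using dng v no by auto
  note cAB = crossing_dangerous[OF dng(1,2) _ _ nb(1)]
  note cAC = crossing_dangerous[OF dng(1,3) _ _ nb(3)]
  note cBC = crossing_dangerous[OF dng(2,3) _ _ nb(2)]
  have nAB: "nb (A \<inter> B) = 1" using v n by (intro cAB(5)) auto
  have nAC: "nb (A \<inter> C) = 1" using v n by (intro cAC(5)) auto
  have nBC: "nb (B \<inter> C) = 1" using v n by (intro cBC(5)) auto
  have sub: "A \<subseteq> W" "B \<subseteq> W" "C \<subseteq> W" "A \<subseteq> V" "B \<subseteq> V" using dng dngD(1) by auto
  have "nb A + nb B = degree G s + 1" using nb_Un[OF sub(1,2)] nAB nb_W AB by simp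
  then have nA: "2 * nb A = degree G s + 1" "2 * nb B = degree G s + 1"
    using dangerous_nb_le[OF dng(1)] dangerous_nb_le[OF dng(2)] by linarith+
  have nC: "nb C \<le> 2"
  proof -
    have "C = (A \<inter> C) \<union> (B \<inter> C)" using AB sub by auto
    then have "nb C \<le> nb (A \<inter> C) + nb (B \<inter> C)"
      using nb_Un[of "A \<inter> C" "B \<inter> C"] sub by (metis le_add1 le_infI1)
    then show ?thesis using nAC nBC by simp
  qed
  have "A \<union> C \<noteq> W"
  proof
    assume "A \<union> C = W"
    then have "nb A + nb C = degree G s + 1" using nb_Un[OF sub(1,3)] nAC nb_W by simp
    then show False using nA nC deg by linarith
  qed
  moreover have "B \<union> C \<noteq> W"
  proof
    assume "B \<union> C = W"
    then have "nb B + nb C = degree G s + 1" using nb_Un[OF sub(2,3)] nBC nb_W by simp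
    then show False using nA nC deg by linarith
  qed
  moreover have "\<not> dng (A \<union> C)" "\<not> dng (B \<union> C)" using no v by blast+
  moreover have "\<not> A \<subseteq> C" "\<not> C \<subseteq> A" "\<not> B \<subseteq> C" "\<not> C \<subseteq> B" using v n by blast+
  ultimately have l: "linked A C" "linked B C" using dng nb unfolding linked_def by simp_all
  have r: "(k - 1) div 2 \<le> ee (A - B) (B - A)" using linked_triangle(2)[OF l] v n by auto
  have dA: "d A = k + 1" "d (A - B) = k" using v n by (intro cAB; auto)+
  have "A \<inter> B \<noteq> {}" "A \<inter> B \<subseteq> W" "A \<inter> B \<noteq> W" using v dngD(3)[OF dng(1)] sub by auto
  then have "k \<le> d (A \<inter> B)" by (intro d_ge_k)
  moreover have "V - (A \<union> B) = {s}" using AB root by auto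
  moreover have "nb A = nb (A - B) + nb (A \<inter> B)"
  proof -
    have "(A - B) \<union> (A \<inter> B) = A" "(A - B) \<inter> (A \<inter> B) = {}" "A - B \<subseteq> W" "A \<inter> B \<subseteq> W"
      using sub(1) by auto
    then show ?thesis using nb_Un[of "A - B" "A \<inter> B"] by simp
  qed
  moreover have "odd k" using linkedD(1)[OF l(1)] .
  then have "k = 2 * ((k - 1) div 2) + 1" by (auto elim: oddE)
  \<comment> \<open>At least \<open>(k - 1) div 2\<close> edges run from each of
    \<open>A - B\<close> and \<open>A \<inter> B\<close> to \<open>B - A\<close>, and
    \<open>nb A \<ge> 3\<close> edges from \<open>A\<close> to \<open>s\<close>; this exceeds
    \<open>d A = k + 1\<close>.\<close>
  ultimately show False using cut_two_sets[OF sub(4,5)] dA r nAB nA deg by simp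
qed

end

text \<open>Otherwise no two of the sets cover \<open>W\<close> and all three pairs are linked. Then
  \<open>linked_triangle\<close> puts \<open>(k - 1) div 2 \<ge> 1\<close> edges between
  \<open>A - B\<close> and \<open>B - A\<close>, where linked sets have none.\<close>

lemma triple_in_dangerous:
  assumes dng: "dng A" "dng B" "dng C"
    and nb: "1 \<le> nb (A \<inter> B)" "1 \<le> nb (B \<inter> C)" "1 \<le> nb (A \<inter> C)"
    and v: "v1 \<in> A \<inter> C" "v2 \<in> A \<inter> B" "v3 \<in> B \<inter> C"
  shows "\<exists>X. dng X \<and> v1 \<in> X \<and> v2 \<in> X \<and> v3 \<in> X"
proof (rule ccontr)
  assume "\<not> ?thesis"
  then have no: "\<And>X. dng X \<Longrightarrow> \<not> (v1 \<in> X \<and> v2 \<in> X \<and> v3 \<in> X)" by blast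
  have n: "v3 \<notin> A" "v1 \<notin> B" "v2 \<notin> C" using dng v no by auto
  have "A \<union> B \<noteq> W" using no_triangle_cover[OF dng nb v no] by simp
  moreover have "A \<union> C \<noteq> W"
    by (rule no_triangle_cover[of A C B v2 v1 v3]) (use dng nb v no in \<open>auto simp: Int_commute\<close>)
  moreover have "B \<union> C \<noteq> W"
    by (rule no_triangle_cover[of B C A v2 v3 v1]) (use dng nb v no in \<open>auto simp: Int_commute\<close>)
  moreover have "\<not> dng (A \<union> C)" "\<not> dng (B \<union> C)" "\<not> dng (A \<union> B)" using no v by blast+
  moreover have "\<not> A \<subseteq> B" "\<not> B \<subseteq> A" "\<not> A \<subseteq> C" "\<not> C \<subseteq> A" "\<not> B \<subseteq> C" "\<not> C \<subseteq> B" using v n by blast+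
  ultimately have l: "linked A C" "linked B C" "linked A B"
    using dng nb unfolding linked_def by simp_all
  have "(k - 1) div 2 \<le> 0"
    using linked_triangle(2)[OF l(1,2)] v n linkedD(9)[OF l(3)] by auto
  then show False using linkedD(1)[OF l(1)] k_ge_2 by (auto elim!: oddE)
qed

text \<open>Take a dangerous \<open>A\<close> containing the ends of as many edges of
  \<open>F\<close> as possible. A missed edge and two covered ones have their ends in one dangerous
  \<open>X\<close> by \<open>triple_in_dangerous\<close>. Sharing two edges to \<open>s\<close>,
  \<open>A\<close> and \<open>X\<close> are comparable, so \<open>X\<close> covers more of
  \<open>F\<close>.\<close>

lemma independent_in_dangerous:
  assumes F: "independent_set L F" "2 \<le> card F"
  shows "\<exists>A. dng A \<and> other_end G s ` F \<subseteq> A"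
proof -
  have sub: "F \<subseteq> edges_at G s" using F(1) by (simp add: independent_set_def)
  then have finF: "finite F" using finite_subset[OF _ finite_edges_at] by blast
  have pair: "\<exists>A. dng A \<and> other_end G s e \<in> A \<and> other_end G s f \<in> A" if "e \<in> F" "f \<in> F" "e \<noteq> f" for e f
  proof -
    have "\<not> adjacent L e f" "e \<in> edges_at G s" "f \<in> edges_at G s"
      using F(1) that sub by (auto simp: independent_set_def)
    then show ?thesis using that(3) unfolding adjacent_L by blast
  qed
  have finA: "finite {A. dng A}"
    by (rule finite_subset[of _ "Pow V"]) (use finV in \<open>auto simp: dangerous_iff\<close>)
  obtain e f where ef: "e \<in> F" "f \<in> F" "e \<noteq> f"
    using F(2) by (metis One_nat_def Suc_1 card_le_Suc0_iff_eq finF not_less_eq_eq)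
  \<comment> \<open>Edges are counted rather than ends, as parallel edges of \<open>F\<close> share
    an end.\<close>
  let ?n = "\<lambda>A. card (F \<inter> root_edges A)"
  have ne: "{A. dng A} \<noteq> {}" using pair[OF ef] by auto
  have "Max (?n ` {A. dng A}) \<in> ?n ` {A. dng A}" using finA ne by (intro Max_in) auto
  then obtain A where A: "dng A" "?n A = Max (?n ` {A. dng A})" by auto
  have max: "?n B \<le> ?n A" if "dng B" for B
    unfolding A(2) using finA that by (intro Max_ge) auto
  note A = A(1)
  have card2: "2 \<le> ?n A"
  proof -
    obtain B where B: "dng B" "other_end G s e \<in> B" "other_end G s f \<in> B" using pair[OF ef] by auto
    have "card {e, f} \<le> ?n B" using B ef sub finF by (intro card_mono) (auto simp: root_edges_def)
    then show ?thesis using max[OF B(1)] ef by simp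
  qed
  have "other_end G s g \<in> A" if g: "g \<in> F" for g
  proof (rule ccontr)
    assume gA: "other_end G s g \<notin> A"
    obtain e f where ef: "e \<in> F \<inter> root_edges A" "f \<in> F \<inter> root_edges A" "e \<noteq> f"
      using card2 by (metis One_nat_def Suc_1 card_le_Suc0_iff_eq finF finite_Int not_less_eq_eq)
    then have oe: "other_end G s e \<in> A" "other_end G s f \<in> A" "e \<noteq> g" "f \<noteq> g"
      using gA by (auto simp: root_edges_def)
    obtain B where B: "dng B" "other_end G s f \<in> B" "other_end G s g \<in> B" using pair ef oe g by blast
    obtain C where C: "dng C" "other_end G s e \<in> C" "other_end G s g \<in> C" using pair ef oe g by blast
    have subs: "A \<subseteq> W" "B \<subseteq> W" "C \<subseteq> W" using A B C dngD(1) by auto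
    have E: "e \<in> edges_at G s" "f \<in> edges_at G s" "g \<in> edges_at G s" using ef g sub by auto
    have "\<exists>X. dng X \<and> other_end G s e \<in> X \<and> other_end G s f \<in> X \<and> other_end G s g \<in> X"
    proof (rule triple_in_dangerous[OF A B(1) C(1)])
      show "1 \<le> nb (A \<inter> B)" by (rule nb_ge_1[of _ f]) (use subs E oe B in \<open>auto simp: root_edges_def\<close>)
      show "1 \<le> nb (B \<inter> C)" by (rule nb_ge_1[of _ g]) (use subs E C B in \<open>auto simp: root_edges_def\<close>)
      show "1 \<le> nb (A \<inter> C)" by (rule nb_ge_1[of _ e]) (use subs E oe C in \<open>auto simp: root_edges_def\<close>)
    qed (use oe B C in auto)
    then obtain X where X: "dng X" "other_end G s e \<in> X" "other_end G s f \<in> X" "other_end G s g \<in> X"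
      by blast
    have "card {e, f} \<le> card (root_edges (A \<inter> X))"
      using X oe E by (intro card_mono) (auto simp: root_edges_def)
    moreover have "A \<inter> X \<subseteq> W" using subs by auto
    ultimately have "2 \<le> nb (A \<inter> X)" using ef(3) nb_eq[of "A \<inter> X"] by simp
    then have "A \<subseteq> X" using dangerous_comparable[OF A X(1)] X gA by auto
    then have "F \<inter> root_edges A \<subset> F \<inter> root_edges X"
      using root_edges_mono[of A X] X g E gA by (auto simp: root_edges_def)
    then have "?n A < ?n X" using finF by (intro psubset_card_mono) auto
    then show False using max[OF X(1)] by simp
  qed
  then show ?thesis using A by blast
qed

end

section \<open>Graphs of maximum degree two\<close>

locale max_degree_two_graph =
  fixes H :: "('a, 'a set) mgraph" and V :: "'a set"
  assumes V: "vertices H = V" "finite V" "V \<noteq> {}"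
    and irrefl: "\<not> adjacent H x x"
    and adj_V: "adjacent H x y \<Longrightarrow> x \<in> V"
    and deg2: "adjacent H u x \<Longrightarrow> adjacent H u y \<Longrightarrow> adjacent H u z \<Longrightarrow> x = y \<or> x = z \<or> y = z"
    and conn: "u \<in> V \<Longrightarrow> v \<in> V \<Longrightarrow> (adjacent H)\<^sup>*\<^sup>* u v"
begin

definition adj_list :: "'a list \<Rightarrow> bool" where
  "adj_list xs \<longleftrightarrow> xs \<noteq> [] \<and> distinct xs \<and> set xs \<subseteq> V \<and>
     (\<forall>i. Suc i < length xs \<longrightarrow> adjacent H (xs ! i) (xs ! Suc i))"

lemma ex_longest: "\<exists>xs. adj_list xs \<and> (\<forall>ys. adj_list ys \<longrightarrow> length ys \<le> length xs)"
proof -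
  obtain v where "v \<in> V" using V by blast
  then have "adj_list [v]" by (simp add: adj_list_def)
  moreover have "\<forall>ys. adj_list ys \<longrightarrow> length ys < Suc (card V)"
    using V(2) card_mono[of V] by (metis adj_list_def distinct_card le_imp_less_Suc)
  ultimately show ?thesis using ex_has_greatest_nat[of adj_list "[v]" length "Suc (card V)"] by blast
qed

text \<open>A longest \<open>adj_list\<close> is closed under neighbours: a new neighbour of an end
  vertex would extend it, and an inner vertex already has two. By connectedness it covers
  \<open>V\<close>, and the only further adjacency possible joins its first and last
  entries.\<close>

lemma path_or_cycle: "is_path_graph H \<or> is_cycle_graph H"
proof -
  obtain xs where xs: "adj_list xs" and longest: "\<And>ys. adj_list ys \<Longrightarrow> length ys \<le> length xs"
    using ex_longest by blast
  define n where "n = length xs"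
  have n: "0 < n" and dist: "distinct xs" and sub: "set xs \<subseteq> V"
    and step: "\<And>i. Suc i < n \<Longrightarrow> adjacent H (xs ! i) (xs ! Suc i)"
    using xs by (auto simp: adj_list_def n_def)
  have eq_iff: "xs ! i = xs ! j \<longleftrightarrow> i = j" if "i < n" "j < n" for i j
    using that dist by (simp add: nth_eq_iff_index_eq n_def)
  have step': "adjacent H (xs ! Suc i) (xs ! i)" if "Suc i < n" for i
    using step[OF that] by (simp add: adjacent_commute)
  have interior: "y = xs ! (i - 1) \<or> y = xs ! (i + 1)"
    if "0 < i" "i + 1 < n" "adjacent H (xs ! i) y" for i y
    using deg2[of "xs ! i" "xs ! (i - 1)" "xs ! (i + 1)" y] step[of i] step'[of "i - 1"] that
      eq_iff[of "i - 1" "i + 1"] by auto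
  have closed: "y \<in> set xs" if i: "i < n" "adjacent H (xs ! i) y" for i y
  proof (rule ccontr)
    assume y: "y \<notin> set xs"
    have yV: "y \<in> V" using i adj_V adjacent_commute by metis
    consider "i = 0" | "i = n - 1" | "0 < i" "i + 1 < n" using i by linarith
    then show False
    proof cases
      case 1
      have "adj_list (y # xs)" unfolding adj_list_def
      proof (intro conjI allI impI)
        fix j assume "Suc j < length (y # xs)"
        then show "adjacent H ((y # xs) ! j) ((y # xs) ! Suc j)"
          using i 1 step by (cases j) (auto simp: adjacent_commute n_def)
      qed (use y yV dist sub in auto)
      then show False using longest by fastforce
    next
      case 2
      have "adj_list (xs @ [y])" unfolding adj_list_def
      proof (intro conjI allI impI)
        fix j assume j: "Suc j < length (xs @ [y])"
        show "adjacent H ((xs @ [y]) ! j) ((xs @ [y]) ! Suc j)"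
        proof (cases "Suc j < n")
          case True
          then show ?thesis using step[of j] by (simp add: nth_append n_def)
        next
          case False
          then have "j = i" "Suc j = n" using j 2 by (auto simp: n_def)
          then show ?thesis using i by (simp add: nth_append n_def)
        qed
      qed (use y yV dist sub in auto)
      then show False using longest by fastforce
    next
      case 3
      then show False using interior[of i y] i y by (auto simp: n_def)
    qed
  qed
  have "v \<in> set xs" if "v \<in> V" for v
  proof -
    have "xs ! 0 \<in> V" using n sub by (auto simp: n_def)
    from conn[OF this that] show ?thesis
    proof (induction rule: rtranclp_induct)
      case base
      then show ?case using n by (simp add: n_def)
    next
      case (step y z)
      then show ?case using closed by (metis in_set_conv_nth n_def)
    qed
  qed
  then have set_xs: "set xs = V" using sub by auto
  have adj_less: "j = i + 1 \<or> (i = 0 \<and> j = n - 1)"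
    if ij: "i < j" "j < n" "adjacent H (xs ! i) (xs ! j)" for i j
  proof (cases "i = 0")
    case False
    then show ?thesis using interior[of i "xs ! j"] ij eq_iff[of j "i - 1"] eq_iff[of j "i + 1"] by auto
  next
    case True
    show ?thesis
    proof (cases "j = n - 1")
      case False
      then have "j + 1 < n" using ij by linarith
      then show ?thesis
        using True interior[of j "xs ! i"] ij eq_iff[of i "j - 1"] eq_iff[of i "j + 1"]
        by (auto simp: adjacent_commute)
    qed (use True in simp)
  qed
  define x where "x i = xs ! (i - 1)" for i
  have bij: "bij_betw x {1..n} (vertices H)"
  proof -
    have "x ` {1..n} = set xs"
    proof -
      have "x ` {1..n} = (\<lambda>i. xs ! i) ` {..<n}"
        by (force simp: x_def image_iff intro: bexI[of _ "Suc _"])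
      then show ?thesis by (auto simp: n_def set_conv_nth)
    qed
    moreover have "inj_on x {1..n}" by (rule inj_onI) (auto simp: x_def eq_iff)
    ultimately show ?thesis using V(1) set_xs by (simp add: bij_betw_def)
  qed
  have key: "j = i + 1 \<or> (i = 1 \<and> j = n)"
    if ij: "i < j" "1 \<le> i" "j \<le> n" "adjacent H (x i) (x j)" for i j
  proof -
    have "i - 1 < j - 1" "j - 1 < n" "adjacent H (xs ! (i - 1)) (xs ! (j - 1))"
      using ij by (simp_all add: x_def less_diff_conv2 diff_less_mono)
    from adj_less[OF this] show ?thesis using ij by linarith
  qed
  have adj_x: "adjacent H (x i) (x j) \<longleftrightarrow> j = i + 1 \<or> i = j + 1 \<or>
      (i = 1 \<and> j = n \<or> i = n \<and> j = 1) \<and> adjacent H (x 1) (x n)"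
    if ij: "i \<in> {1..n}" "j \<in> {1..n}" for i j
  proof
    assume a: "adjacent H (x i) (x j)"
    then have "i \<noteq> j" using irrefl by auto
    then consider "i < j" | "j < i" by linarith
    then show "j = i + 1 \<or> i = j + 1 \<or>
      (i = 1 \<and> j = n \<or> i = n \<and> j = 1) \<and> adjacent H (x 1) (x n)"
    proof cases
      case 1
      then show ?thesis using key[of i j] ij a by auto
    next
      case 2
      then show ?thesis using key[of j i] ij a by (auto simp: adjacent_commute)
    qed
  next
    assume "j = i + 1 \<or> i = j + 1 \<or> (i = 1 \<and> j = n \<or> i = n \<and> j = 1) \<and> adjacent H (x 1) (x n)"
    moreover have "adjacent H (x i') (x (i' + 1))" if "1 \<le> i'" "i' + 1 \<le> n" for i'
      using step[of "i' - 1"] that by (simp add: x_def)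
    ultimately show "adjacent H (x i) (x j)" using ij by (auto simp: adjacent_commute)
  qed
  show ?thesis
  \<comment> \<open>With two vertices the first and the last are already consecutive and form a
    path, hence \<open>3 \<le> n\<close>.\<close>
  proof (cases "3 \<le> n \<and> adjacent H (x 1) (x n)")
    case True
    then have "cycle_order H n x" using bij adj_x by (simp add: cycle_order_def)
    then show ?thesis by (auto simp: is_cycle_graph_def)
  next
    case False
    have "adjacent H (x i) (x j) \<longleftrightarrow> j = i + 1 \<or> i = j + 1" if "i \<in> {1..n}" "j \<in> {1..n}" for i j
    proof (cases "adjacent H (x 1) (x n)")
      case True
      then have "n \<noteq> 1" using irrefl by auto
      then have "n = 2" using False True n by auto
      then have "i = 1 \<and> j = n \<or> i = n \<and> j = 1 \<Longrightarrow> j = i + 1 \<or> i = j + 1" by auto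
      then show ?thesis using adj_x[OF that] by blast
    qed (use adj_x[OF that] in simp)
    then have "path_order H n x" using bij n by (simp add: path_order_def)
    then show ?thesis by (auto simp: is_path_graph_def)
  qed
qed

end

section \<open>Maximal independent sets of the lifting graph\<close>

locale lifting_connected = lifting_setting +
  assumes cL: "connected_graph L" and cC: "connected_graph (complement_graph L)"
begin

abbreviation "mis \<equiv> max_independent_set L"
abbreviation "DS \<equiv> dangerous_set_of G s k"

lemma root_edges_independent: "dng A \<Longrightarrow> independent_set L (root_edges A)"
  by (auto simp: independent_set_def adjacent_L root_edges_def)

lemma mis_superset_eq: "mis I \<Longrightarrow> independent_set L F \<Longrightarrow> I \<subseteq> F \<Longrightarrow> F = I"
  by (simp add: max_independent_set_def)

lemma mis_sub: "mis I \<Longrightarrow> I \<subseteq> edges_at G s"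
  by (simp add: max_independent_set_def independent_set_def)

lemma mis_finite: "mis I \<Longrightarrow> finite I"
  using mis_sub finite_subset[OF _ finite_edges_at] by blast

lemma mis_subset_eq: "mis I \<Longrightarrow> mis J \<Longrightarrow> I \<subseteq> J \<Longrightarrow> I = J"
  unfolding max_independent_set_def by blast

lemma ex_mis:
  assumes "independent_set L F"
  shows "\<exists>I. mis I \<and> F \<subseteq> I"
proof -
  let ?S = "{I. independent_set L I \<and> F \<subseteq> I}"
  have fin: "finite ?S"
    by (rule finite_subset[of _ "Pow (edges_at G s)"]) (auto simp: independent_set_def)
  have ne: "?S \<noteq> {}" using assms by auto
  from finite_has_maximal[OF fin ne] obtain I where I: "independent_set L I" "F \<subseteq> I"
    and max: "\<forall>J\<in>?S. I \<subseteq> J \<longrightarrow> I = J" by auto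
  have "F' = I" if "independent_set L F'" "I \<subseteq> F'" for F' using max that I(2) by auto
  then show ?thesis using I unfolding max_independent_set_def by metis
qed

lemma ex_mis_pair:
  assumes "e \<in> edges_at G s" "f \<in> edges_at G s" "\<not> adjacent L e f"
  shows "\<exists>I. mis I \<and> e \<in> I \<and> f \<in> I"
proof -
  have "independent_set L {e, f}" using assms adjacent_L adjacent_commute[of L]
    by (auto simp: independent_set_def)
  then show ?thesis using ex_mis by blast
qed

lemma other_root_edge:
  assumes "e \<in> edges_at G s"
  obtains f where "f \<in> edges_at G s" "f \<noteq> e"
proof -
  have "\<not> edges_at G s \<subseteq> {e}"
    using deg card_mono[of "{e}" "edges_at G s"] by (auto simp: degree_def)
  then show thesis using that by blast
qed

lemma has_lift_neighbour:
  assumes "e \<in> edges_at G s"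
  obtains f where "adjacent L e f"
  using other_root_edge[OF assms] connected_graph_has_neighbour[OF cL] assms by (metis vertices_L)

lemma has_nonlift_neighbour:
  assumes "e \<in> edges_at G s"
  obtains f where "f \<in> edges_at G s" "f \<noteq> e" "\<not> adjacent L e f"
proof -
  obtain g where "g \<in> edges_at G s" "g \<noteq> e" using other_root_edge[OF assms] .
  moreover have "vertices (complement_graph L) = edges_at G s" by (simp add: complement_graph_def)
  ultimately obtain f where "adjacent (complement_graph L) e f"
    using connected_graph_has_neighbour[OF cC] assms by metis
  then show thesis using that by (auto simp: adjacent_complement_graph)
qed

text \<open>Connectedness of the complement gives every edge at \<open>s\<close> a partner with
  which it is not liftable, so no singleton is maximal. This makes
  \<open>independent_in_dangerous\<close> available.\<close>

lemma mis_card_ge_2: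
  assumes "mis I"
  shows "2 \<le> card I"
proof -
  have "edges_at G s \<noteq> {}" using deg by (auto simp: degree_def)
  then obtain e0 where e0: "e0 \<in> edges_at G s" by blast
  have "I \<noteq> {}"
  proof
    assume "I = {}"
    then show False using ex_mis_pair[OF e0 e0] mis_subset_eq[OF assms]
      by (metis adjacent_L empty_iff empty_subsetI)
  qed
  then obtain e where e: "e \<in> I" by blast
  then have eE: "e \<in> edges_at G s" using mis_sub[OF assms] by auto
  obtain f where f: "f \<in> edges_at G s" "f \<noteq> e" "\<not> adjacent L e f"
    using has_nonlift_neighbour[OF eE] .
  obtain J where J: "mis J" "e \<in> J" "f \<in> J" using ex_mis_pair[OF eE f(1,3)] by blast
  have "I \<noteq> {e}" using mis_subset_eq[OF assms J(1)] J f(2) by auto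
  then obtain g where "g \<in> I" "g \<noteq> e" using e by blast
  then have "card {e, g} \<le> card I" using e mis_finite[OF assms] by (intro card_mono) auto
  then show ?thesis using \<open>g \<noteq> e\<close> by simp
qed

text \<open>Both sets contain the ends of the at least two edges of \<open>I\<close>, so they are
  comparable, and minimality makes them equal. This justifies the \<open>THE\<close> in
  \<open>dangerous_set_of\<close>.\<close>

lemma min_dangerous_unique:
  assumes I: "mis I" and A: "min_dangerous_for G s k I A" and B: "min_dangerous_for G s k I B"
  shows "A = B"
proof -
  have dng: "dng A" "dng B" using A B by (auto simp: min_dangerous_for_def)
  have "I \<subseteq> root_edges (A \<inter> B)"
    using A B mis_sub[OF I] by (auto simp: min_dangerous_for_def root_edges_def)
  then have "card I \<le> card (root_edges (A \<inter> B))" by (intro card_mono) auto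
  moreover have "A \<inter> B \<subseteq> W" using dngD(1)[OF dng(1)] by auto
  ultimately have "2 \<le> nb (A \<inter> B)" using nb_eq[of "A \<inter> B"] mis_card_ge_2[OF I] by simp
  then show ?thesis using dangerous_comparable[OF dng] A B unfolding min_dangerous_for_def by blast
qed

lemma min_dangerous_DS:
  assumes I: "mis I"
  shows "min_dangerous_for G s k I (DS I)"
proof -
  let ?S = "{A. dng A \<and> other_end G s ` I \<subseteq> A}"
  have fin: "finite ?S" by (rule finite_subset[of _ "Pow V"]) (use finV in \<open>auto simp: dangerous_iff\<close>)
  have "independent_set L I" using I by (simp add: max_independent_set_def)
  then have ne: "?S \<noteq> {}" using independent_in_dangerous[of I] mis_card_ge_2[OF I] by simp
  from finite_has_minimal[OF fin ne] obtain A where "A \<in> ?S" "\<forall>B\<in>?S. B \<subseteq> A \<longrightarrow> A = B"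
    by (elim bexE)
  then have A: "min_dangerous_for G s k I A" by (auto simp: min_dangerous_for_def)
  have "DS I = A" unfolding dangerous_set_of_def
    by (rule the_equality[where P = "min_dangerous_for G s k I", OF A])
      (rule min_dangerous_unique[OF I _ A])
  then show ?thesis using A by simp
qed

lemma dng_DS: "mis I \<Longrightarrow> dng (DS I)"
  using min_dangerous_DS by (simp add: min_dangerous_for_def)

text \<open>The root edges of a dangerous set are independent, so maximality of \<open>I\<close>
  rules out further ones.\<close>

lemma root_edges_DS:
  assumes "mis I"
  shows "root_edges (DS I) = I"
proof -
  have "I \<subseteq> root_edges (DS I)" using min_dangerous_DS[OF assms] mis_sub[OF assms]
    by (auto simp: min_dangerous_for_def root_edges_def)
  then show ?thesis using mis_superset_eq[OF assms root_edges_independent[OF dng_DS[OF assms]]] by simp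
qed

lemma DS_sub: "mis I \<Longrightarrow> DS I \<subseteq> W"
  using dng_DS dngD(1) by blast

lemma mis_linked:
  assumes I: "mis I" and J: "mis J" and neq: "I \<noteq> J" and e: "e \<in> I" "e \<in> J"
  shows "linked (DS I) (DS J)"
proof -
  let ?A = "DS I" and ?B = "DS J"
  note A = dng_DS[OF I] root_edges_DS[OF I] and B = dng_DS[OF J] root_edges_DS[OF J]
  have "\<not> ?A \<subseteq> ?B" "\<not> ?B \<subseteq> ?A"
    using root_edges_mono[of ?A ?B] root_edges_mono[of ?B ?A] A B neq mis_subset_eq[OF I J]
      mis_subset_eq[OF J I] by auto
  moreover have "1 \<le> nb (?A \<inter> ?B)"
    by (rule nb_ge_1[of _ e]) (use DS_sub[OF I] A(2) B(2) e in \<open>auto simp: root_edges_def\<close>)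
  moreover have "?A \<union> ?B \<noteq> W"
  proof
    assume un: "?A \<union> ?B = W"
    have eE: "e \<in> edges_at G s" using mis_sub[OF I] e by auto
    \<comment> \<open>As \<open>f\<close> is liftable with \<open>e\<close>, it belongs to neither
      \<open>I\<close> nor \<open>J\<close>, so its end lies outside
      \<open>?A \<union> ?B\<close>.\<close>
    obtain f where f: "adjacent L e f" using has_lift_neighbour[OF eE] .
    then have "f \<in> root_edges ?A \<or> f \<in> root_edges ?B"
      using un ends_other_end(2)[of f] by (auto simp: adjacent_L root_edges_def)
    then have "f \<in> I \<or> f \<in> J" using A B by simp
    then show False using f e I J unfolding max_independent_set_def independent_set_def by blast
  qed
  moreover have "\<not> dng (?A \<union> ?B)"
  proof
    assume "dng (?A \<union> ?B)"
    then have ind: "independent_set L (root_edges (?A \<union> ?B))" by (rule root_edges_independent)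
    have "I \<subseteq> root_edges (?A \<union> ?B)" "J \<subseteq> root_edges (?A \<union> ?B)"
      using root_edges_mono[of ?A "?A \<union> ?B"] root_edges_mono[of ?B "?A \<union> ?B"] A B by auto
    then show False using mis_superset_eq[OF I ind] mis_superset_eq[OF J ind] neq by simp
  qed
  ultimately show ?thesis using A B by (simp add: linked_def)
qed

lemma half_pos: "odd k \<Longrightarrow> 1 \<le> (k - 1) div 2"
  using k_ge_2 by (auto elim!: oddE)

text \<open>The edges between \<open>A \<inter> B\<close> and \<open>A - B\<close>, at least one
  since \<open>k \<ge> 2\<close> is odd, would join \<open>B \<inter> C\<close> to vertices of
  \<open>W\<close> outside \<open>B \<union> C\<close>, which linkedness of \<open>B\<close> and
  \<open>C\<close> forbids.\<close>

lemma linked_no_common_part: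
  assumes AB: "linked A B" and BC: "linked B C"
    and sub: "A \<inter> B \<subseteq> C" "A \<inter> C \<subseteq> B"
  shows False
proof -
  have A: "A \<subseteq> W" using AB dngD(1) by (auto simp: linked_def)
  have "ee (A \<inter> B) (A - B) \<le> ee (B \<inter> C) (W - (B \<union> C))" using sub A by (intro ee_mono) auto
  then show False using linkedD(1,7)[OF AB] linkedD(6)[OF BC] half_pos by simp
qed

lemma no_edge_in_three_mis:
  assumes mis: "mis I" "mis J" "mis K" and neq: "I \<noteq> J" "I \<noteq> K" "J \<noteq> K"
    and e: "e \<in> I" "e \<in> J" "e \<in> K"
  shows False
proof -
  let ?A = "DS I" and ?B = "DS J" and ?C = "DS K"
  have AB: "linked ?A ?B" and AC: "linked ?A ?C" and BC: "linked ?B ?C"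
    using mis_linked mis neq e by blast+
  note sub = DS_sub[OF mis(1)] DS_sub[OF mis(2)] DS_sub[OF mis(3)]
  have proper: "?A \<noteq> W" "?B \<noteq> W" "?C \<noteq> W" using dng_DS mis dngD(3) by blast+
  have v: "other_end G s e \<in> ?A" "other_end G s e \<in> ?B" "other_end G s e \<in> ?C"
    using root_edges_DS[OF mis(1)] root_edges_DS[OF mis(2)] root_edges_DS[OF mis(3)] e
    by (auto simp: root_edges_def)
  have odd: "odd k" by (rule linkedD(1)[OF AB])
  have 1: "?A \<inter> ?B \<subseteq> ?A \<inter> ?C \<or> ?A \<inter> ?C \<subseteq> ?A \<inter> ?B"
    by (rule tight_sets_comparable[OF odd])
      (use sub v proper linkedD(3)[OF AB] linkedD(3)[OF AC] in auto)
  have 2: "?B \<inter> ?A \<subseteq> ?B \<inter> ?C \<or> ?B \<inter> ?C \<subseteq> ?B \<inter> ?A"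
    by (rule tight_sets_comparable[OF odd])
      (use sub v proper linkedD(3)[OF AB] linkedD(3)[OF BC] in \<open>auto simp: Int_commute\<close>)
  have 3: "?C \<inter> ?A \<subseteq> ?C \<inter> ?B \<or> ?C \<inter> ?B \<subseteq> ?C \<inter> ?A"
    by (rule tight_sets_comparable[OF odd])
      (use sub v proper linkedD(3)[OF AC] linkedD(3)[OF BC] in \<open>auto simp: Int_commute\<close>)
  have BA: "linked ?B ?A" and CA: "linked ?C ?A" using AB AC linked_commute by auto
  \<comment> \<open>By 1, 2 and 3, at most one of the inclusions
    \<open>?A \<inter> ?B \<subseteq> ?C\<close>, \<open>?A \<inter> ?C \<subseteq> ?B\<close>,
    \<open>?B \<inter> ?C \<subseteq> ?A\<close> fails; each case is a pair of them.\<close>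
  consider "?A \<inter> ?B \<subseteq> ?C" "?A \<inter> ?C \<subseteq> ?B" | "?B \<inter> ?A \<subseteq> ?C" "?B \<inter> ?C \<subseteq> ?A"
    | "?C \<inter> ?A \<subseteq> ?B" "?C \<inter> ?B \<subseteq> ?A" using 1 2 3 by blast
  then show False
    using linked_no_common_part[OF AB BC] linked_no_common_part[OF BA AC] linked_no_common_part[OF CA AB]
    by cases
qed

text \<open>An edge shared with \<open>J\<close> is not in \<open>K\<close> and conversely, so the
  tight sets \<open>DS I \<inter> DS J\<close> and \<open>DS I \<inter> DS K\<close> are
  incomparable and hence disjoint. The rest is \<open>linked_twice\<close>.\<close>

lemma mis_two_neighbours:
  assumes mis: "mis I" "mis J" "mis K" and neq: "I \<noteq> J" "I \<noteq> K" "J \<noteq> K"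
    and meet: "I \<inter> J \<noteq> {}" "I \<inter> K \<noteq> {}"
  shows "DS I \<inter> DS J \<inter> DS K = {}" "DS I = (DS I \<inter> DS J) \<union> (DS I \<inter> DS K)"
    "ee (DS I \<inter> DS J) (DS I \<inter> DS K) = (k - 1) div 2" "card I = 2"
proof -
  let ?A = "DS I" and ?B = "DS J" and ?C = "DS K"
  obtain e f where e: "e \<in> I" "e \<in> J" and f: "f \<in> I" "f \<in> K" using meet by blast
  have AB: "linked ?A ?B" and AC: "linked ?A ?C" using mis_linked mis neq e f by blast+
  have nKJ: "e \<notin> K" "f \<notin> J" using no_edge_in_three_mis[OF mis neq] e f by auto
  have E: "e \<in> edges_at G s" "f \<in> edges_at G s" using mis_sub[OF mis(1)] e f by auto
  have ve: "other_end G s e \<in> ?A \<inter> ?B" "other_end G s e \<notin> ?C"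
    and vf: "other_end G s f \<in> ?A \<inter> ?C" "other_end G s f \<notin> ?B"
    using root_edges_DS[OF mis(1)] root_edges_DS[OF mis(2)] root_edges_DS[OF mis(3)] e f nKJ E
    unfolding root_edges_def by blast+
  have A: "?A \<subseteq> W" "?A \<noteq> W" using DS_sub[OF mis(1)] dngD(3)[OF dng_DS[OF mis(1)]] by auto
  show disj: "?A \<inter> ?B \<inter> ?C = {}"
  proof (rule ccontr)
    assume "?A \<inter> ?B \<inter> ?C \<noteq> {}"
    then have "?A \<inter> ?B \<subseteq> ?A \<inter> ?C \<or> ?A \<inter> ?C \<subseteq> ?A \<inter> ?B"
      by (intro tight_sets_comparable[OF linkedD(1)[OF AB]])
        (use A linkedD(3)[OF AB] linkedD(3)[OF AC] in auto)
    then show False using ve vf by blast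
  qed
  show "DS I = (DS I \<inter> DS J) \<union> (DS I \<inter> DS K)"
    "ee (DS I \<inter> DS J) (DS I \<inter> DS K) = (k - 1) div 2"
    by (rule linked_twice[OF AB AC disj])+
  show "card I = 2" using linked_twice(3)[OF AB AC disj] nb_eq[OF A(1)] root_edges_DS[OF mis(1)] by simp
qed

text \<open>Edges shared with three different neighbours would be distinct, whereas two neighbours
  already force \<open>card I = 2\<close>.\<close>

lemma mis_at_most_two_neighbours:
  assumes mis: "mis I" "mis J1" "mis J2" "mis J3" and neq: "I \<noteq> J1" "I \<noteq> J2" "I \<noteq> J3"
    and meet: "I \<inter> J1 \<noteq> {}" "I \<inter> J2 \<noteq> {}" "I \<inter> J3 \<noteq> {}"
  shows "J1 = J2 \<or> J1 = J3 \<or> J2 = J3"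
proof (rule ccontr)
  assume n: "\<not> ?thesis"
  obtain e1 e2 e3 where e: "e1 \<in> I \<inter> J1" "e2 \<in> I \<inter> J2" "e3 \<in> I \<inter> J3" using meet by blast
  have "e1 \<noteq> e2" "e1 \<noteq> e3" "e2 \<noteq> e3"
    using no_edge_in_three_mis mis neq n e by blast+
  then have "card {e1, e2, e3} = 3" by simp
  moreover have "card {e1, e2, e3} \<le> card I" using e mis_finite[OF mis(1)] by (intro card_mono) auto
  moreover have "card I = 2" using mis_two_neighbours(4)[of I J1 J2] mis neq n meet by blast
  ultimately show False by simp
qed

section \<open>The independence graph: connected, of maximum degree two\<close>

abbreviation "IL \<equiv> independence_graph L"

lemma vertices_IL: "vertices IL = {I. mis I}"
  by (simp add: independence_graph_def)

lemma adjacent_IL: "adjacent IL I J \<longleftrightarrow> mis I \<and> mis J \<and> I \<noteq> J \<and> I \<inter> J \<noteq> {}"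
  by (auto simp: independence_graph_def adjacent_simple_graph)

text \<open>Consecutive edges on a path in the complement of \<open>L\<close> lie in a common
  maximal independent set, and consecutive such sets share an edge, which traces a walk in
  \<open>IL\<close>.\<close>

lemma IL_connected:
  assumes I: "mis I" and J: "mis J"
  shows "(adjacent IL)\<^sup>*\<^sup>* I J"
proof -
  have ne: "I \<noteq> {}" "J \<noteq> {}" using mis_card_ge_2[OF I] mis_card_ge_2[OF J] by auto
  then obtain e f where e: "e \<in> I" and f: "f \<in> J" by blast
  have refl_step: "(adjacent IL)\<^sup>*\<^sup>* I' K" if "(adjacent IL)\<^sup>*\<^sup>* I' J'" "mis J'" "mis K" "g \<in> J'" "g \<in> K" for I' J' K g
    using that adjacent_IL[of J' K] by (cases "J' = K") (auto intro: rtranclp.rtrancl_into_rtrancl)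
  have "vertices (complement_graph L) = edges_at G s" by (simp add: complement_graph_def)
  then have "(adjacent (complement_graph L))\<^sup>*\<^sup>* e f"
    using connected_graph_rtranclp[OF cC, of e f] mis_sub[OF I] mis_sub[OF J] e f by blast
  then have "\<exists>K. mis K \<and> f \<in> K \<and> (adjacent IL)\<^sup>*\<^sup>* I K"
  proof (induction rule: rtranclp_induct)
    case base
    then show ?case using I e by blast
  next
    case (step y z)
    then obtain K where K: "mis K" "y \<in> K" "(adjacent IL)\<^sup>*\<^sup>* I K" by blast
    have "y \<in> edges_at G s" "z \<in> edges_at G s" "\<not> adjacent L y z"
      using step(2) by (auto simp: adjacent_complement_graph)
    then obtain K' where K': "mis K'" "y \<in> K'" "z \<in> K'" using ex_mis_pair by blast
    then show ?case using refl_step[OF K(3,1) K'(1) K(2) K'(2)] by blast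
  qed
  then obtain K where "mis K" "f \<in> K" "(adjacent IL)\<^sup>*\<^sup>* I K" by blast
  then show ?thesis using refl_step[OF _ _ J _ f] by blast
qed

lemma IL_path_or_cycle: "is_path_graph IL \<or> is_cycle_graph IL"
proof -
  interpret max_degree_two_graph IL "{I. mis I}"
  proof
    show "vertices IL = {I. mis I}" by (rule vertices_IL)
    show "finite {I. mis I}"
      by (rule finite_subset[of _ "Pow (edges_at G s)"]) (use mis_sub in auto)
    show "{I. mis I} \<noteq> {}" using ex_mis[of "{}"] by (auto simp: independent_set_def)
    show "\<not> adjacent IL x x" for x by (simp add: adjacent_IL)
    show "x \<in> {I. mis I}" if "adjacent IL x y" for x y using that by (simp add: adjacent_IL)
    show "x = y \<or> x = z \<or> y = z" if "adjacent IL u x" "adjacent IL u y" "adjacent IL u z" for u x y z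
      using that mis_at_most_two_neighbours[of u x y z] by (simp add: adjacent_IL)
    show "(adjacent IL)\<^sup>*\<^sup>* u v" if "u \<in> {I. mis I}" "v \<in> {I. mis I}" for u v
      using IL_connected that by simp
  qed
  show ?thesis by (rule path_or_cycle)
qed

end

section \<open>Cycle and path structures\<close>

lemma vertices_induced_subgraph [simp]: "vertices (induced_subgraph G X) = X"
  by (simp add: induced_subgraph_def)

context lifting_connected begin

lemma subgraph_induced:
  assumes "X \<subseteq> W"
  shows "subgraph (induced_subgraph G X) (delete_vertex G s)"
  using mg assms finite_subset[OF assms] unfolding multigraph_def subgraph_def
  by (auto simp: induced_subgraph_def delete_vertex_def)

lemma regular_blob_linked:
  assumes "linked A B"
  shows "regular_blob G s ((k - 1) div 2) (induced_subgraph G (A - B))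
    (induced_subgraph G (A \<inter> B)) (induced_subgraph G (B - A))"
proof -
  have "2 * ((k - 1) div 2) + 1 = k" using linkedD(1)[OF assms] by (auto elim: oddE)
  then show ?thesis using linkedD[OF assms] by (simp add: regular_blob_def)
qed

text \<open>The end of \<open>g\<close> witnesses \<open>X \<union> Y \<noteq> W\<close>, so
  intersecting tight sets would be nested, and so would their nonempty disjoint sets of root
  edges.\<close>

lemma tight_root_disjoint:
  assumes "odd k" and X: "X \<subseteq> W" "d X = k" and Y: "Y \<subseteq> W" "d Y = k"
    and disj: "root_edges X \<inter> root_edges Y = {}" and "root_edges X \<noteq> {}" "root_edges Y \<noteq> {}"
    and g: "g \<in> edges_at G s" "g \<notin> root_edges X" "g \<notin> root_edges Y"
  shows "X \<inter> Y = {}"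
proof (rule ccontr)
  assume ne: "X \<inter> Y \<noteq> {}"
  have "other_end G s g \<in> W" "other_end G s g \<notin> X \<union> Y"
    using g ends_other_end(2) by (auto simp: root_edges_def)
  then have "X \<union> Y \<noteq> W" by blast
  from tight_sets_comparable[OF assms(1) X Y ne this]
  have "root_edges X \<subseteq> root_edges Y \<or> root_edges Y \<subseteq> root_edges X"
    using root_edges_mono by blast
  then show False using assms by blast
qed

lemma d_root_split: "X \<subseteq> W \<Longrightarrow> d X = nb X + ee X (W - X)"
  using d_eq[of X] ee_outside[of X X] by auto

text \<open>Of the \<open>k\<close> edges leaving \<open>X\<close>, at least one goes to
  \<open>s\<close> and \<open>(k - 1) div 2\<close> go to \<open>Y\<close>, which leaves at most
  \<open>(k - 1) div 2\<close> for \<open>Z\<close>.\<close>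

lemma tight_end_bound:
  assumes "odd k" and X: "X \<subseteq> W" "d X = k" "1 \<le> nb X" "ee X Y = (k - 1) div 2"
    and sub: "Y \<subseteq> W" "Z \<subseteq> W" "X \<inter> Y = {}" "X \<inter> Z = {}" "Y \<inter> Z = {}"
  shows "ee X Z \<le> (k - 1) div 2"
proof -
  have "ee X Y + ee X Z = ee X (Y \<union> Z)" using sub by (intro ee_Un_right[symmetric]) auto
  also have "\<dots> \<le> ee X (W - X)" using sub by (intro ee_mono) auto
  finally have "ee X Y + ee X Z + 1 \<le> k" using X d_root_split[OF X(1)] by linarith
  moreover have "k = 2 * ((k - 1) div 2) + 1" using assms(1) by (auto elim: oddE)
  ultimately show ?thesis using X(4) by linarith
qed

lemma root_edge_in_mis: "e \<in> edges_at G s \<Longrightarrow> \<exists>I. mis I \<and> e \<in> I"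
  using ex_mis_pair[of e e] by (auto simp: adjacent_L)

lemma root_edges_Int: "root_edges (X \<inter> Y) = root_edges X \<inter> root_edges Y"
  by (auto simp: root_edges_def)

lemma root_edges_linked_single:
  assumes "linked A B"
  obtains e where "root_edges (A \<inter> B) = {e}"
proof -
  have "A \<inter> B \<subseteq> W" using assms dngD(1) by (auto simp: linked_def)
  then have "card (root_edges (A \<inter> B)) = 1" using linkedD(5)[OF assms] nb_eq by simp
  then show thesis using that by (rule card_1_singletonE)
qed

lemma no_edge_leaving_linked:
  assumes "linked A B" "Z \<subseteq> W" "Z \<inter> (A \<union> B) = {}"
  shows "edges_between G Z (A \<inter> B) = {}"
proof -
  have "edges_between G (A \<inter> B) (W - (A \<union> B)) = {}"
    using linkedD(6)[OF assms(1)] fin_between by simp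
  moreover have "edges_between G Z (A \<inter> B) \<subseteq> edges_between G (W - (A \<union> B)) (A \<inter> B)"
    using assms(2,3) unfolding edges_between_def by blast
  ultimately show ?thesis by (simp add: edges_between_commute)
qed

lemma nb_outside_cover:
  assumes Z: "Z \<subseteq> W" and A: "\<And>I. mis I \<Longrightarrow> DS I \<inter> Z = {}"
  shows "nb Z = 0"
proof -
  have "root_edges Z = {}"
  proof (rule ccontr)
    assume "root_edges Z \<noteq> {}"
    then obtain e where e: "e \<in> edges_at G s" "other_end G s e \<in> Z" by (auto simp: root_edges_def)
    then obtain I where I: "mis I" "e \<in> I" using root_edge_in_mis by blast
    then have "other_end G s e \<in> DS I" using root_edges_DS[OF I(1)] by (auto simp: root_edges_def)
    then show False using A[OF I(1)] e by blast
  qed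
  then show ?thesis using nb_eq[OF Z] by simp
qed

lemma cycle_case:
  assumes cyc: "cycle_order IL m I" and A: "\<And>i. i \<in> {1..m} \<Longrightarrow> A i = DS (I i)"
  shows "odd k" and "cycle_structure G s ((k - 1) div 2) m
    (\<lambda>i. induced_subgraph G (if i = 0 then A m \<inter> A 1 else A i \<inter> A (i + 1)))"
proof -
  \<comment> \<open>\<open>c\<close> maps any index to its representative in \<open>{1..m}\<close>,
    with \<open>m\<close> standing for residue 0. This makes \<open>J\<close>, \<open>B\<close> and
    \<open>X\<close> periodic, so wrapping around needs no separate cases.\<close>
  define c where "c i = (if i mod m = 0 then m else i mod m)" for i
  define J where "J i = I (c i)" for i
  define B where "B i = DS (J i)" for i
  define X where "X i = B i \<inter> B (i + 1)" for i
  have m: "3 \<le> m" and bij: "bij_betw I {1..m} {F. mis F}"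
    and adj: "\<And>i j. i \<in> {1..m} \<Longrightarrow> j \<in> {1..m} \<Longrightarrow> adjacent IL (I i) (I j) \<longleftrightarrow>
        j = i + 1 \<or> i = j + 1 \<or> (i = 1 \<and> j = m) \<or> (i = m \<and> j = 1)"
    using cyc by (auto simp: cycle_order_def vertices_IL)
  have c: "c i \<in> {1..m}" for i using m by (auto simp: c_def intro: less_imp_le)
  have c_id: "c i = i" if "1 \<le> i" "i \<le> m" for i using that by (auto simp: c_def le_less)
  have c_eq: "c i = c j \<longleftrightarrow> i mod m = j mod m" for i j
  proof -
    have "i mod m \<noteq> m" "j mod m \<noteq> m"
      using m mod_less_divisor[of m i] mod_less_divisor[of m j] by linarith+
    then show ?thesis by (cases "i mod m = 0"; cases "j mod m = 0") (simp_all only: c_def if_True if_False, auto)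
  qed
  have J_eq: "J i = J j \<longleftrightarrow> i mod m = j mod m" for i j
    unfolding J_def using bij c c_eq by (metis bij_betw_imp_inj_on inj_on_eq_iff)
  have misJ: "mis (J i)" for i using bij c unfolding J_def bij_betw_def by blast
  \<comment> \<open>Here \<open>m \<ge> 3\<close> matters: the two neighbours of a set on the cycle
    are distinct.\<close>
  have neq1: "i mod m \<noteq> (i + 1) mod m" and neq2: "i mod m \<noteq> (i + 2) mod m" for i
    using m by (simp_all add: mod_Suc)
  have meet: "J i \<inter> J (i + 1) \<noteq> {}" for i
  proof -
    have "c (i + 1) = c i + 1 \<or> c i = m \<and> c (i + 1) = 1"
      using m by (auto simp: c_def mod_Suc)
    then have "adjacent IL (J i) (J (i + 1))" unfolding J_def using adj[OF c c] by blast
    then show ?thesis by (simp add: adjacent_IL)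
  qed
  have link: "linked (B i) (B (i + 1))" for i
    unfolding B_def using mis_linked[OF misJ misJ] J_eq neq1 meet[of i] by blast
  then show odd: "odd k" using linkedD(1) by blast
  have two: "B (j + 1) = X j \<union> X (j + 1)" "X j \<inter> X (j + 1) = {}" for j
  proof -
    have n: "J (j + 1) \<noteq> J j" "J (j + 1) \<noteq> J (j + 2)" "J j \<noteq> J (j + 2)"
      using J_eq neq1[of j] neq2[of j] neq1[of "j + 1"] by auto
    have mt: "J (j + 1) \<inter> J j \<noteq> {}" "J (j + 1) \<inter> J (j + 2) \<noteq> {}"
      using meet[of j] meet[of "j + 1"] by (auto simp: Int_commute)
    note tw = mis_two_neighbours[OF misJ misJ misJ n mt]
    from tw(1,2) show "B (j + 1) = X j \<union> X (j + 1)" "X j \<inter> X (j + 1) = {}"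
      by (auto simp: X_def B_def)
  qed
  have X_mod: "X (i mod m) = X i" for i
  proof -
    have "J (i mod m) = J i" "J (i mod m + 1) = J (i + 1)" using J_eq by (simp_all add: mod_Suc_eq)
    then show ?thesis by (simp add: X_def B_def)
  qed
  have B_sub: "B i \<subseteq> W" for i using DS_sub[OF misJ] by (simp add: B_def)
  have X_sub: "X i \<subseteq> W" for i using B_sub by (auto simp: X_def)
  have dX: "d (X i) = k" for i using linkedD(3)[OF link] by (simp add: X_def)
  \<comment> \<open>Periodic indexing gives \<open>B 0 = A m\<close>, so blob 0 is the one that
    closes the cycle.\<close>
  have X_eq: "X i = (if i = 0 then A m \<inter> A 1 else A i \<inter> A (i + 1))" if "i < m" for i
  proof -
    have "B 0 = A m" using A m by (simp add: B_def J_def c_def)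
    moreover have "B i = A i" if "1 \<le> i" "i \<le> m" for i
      using A c_id[OF that] that by (simp add: B_def J_def)
    ultimately show ?thesis using that m by (auto simp: X_def)
  qed
  have regular: "regular_blob G s ((k - 1) div 2) (induced_subgraph G (X j))
      (induced_subgraph G (X (j + 1))) (induced_subgraph G (X (j + 2)))" for j
  proof -
    have "B (j + 1) - B (j + 2) = X j" "B (j + 1) \<inter> B (j + 2) = X (j + 1)"
      "B (j + 2) - B (j + 1) = X (j + 2)"
      using two[of j] two[of "j + 1"] by (auto simp: X_def)
    then show ?thesis using regular_blob_linked[OF link[of "j + 1"]] by simp
  qed
  \<comment> \<open>A common root edge would lie in three distinct maximal independent sets:
    \<open>J i\<close>, \<open>J (i + 1)\<close>, and \<open>J j\<close> or
    \<open>J (i + 2)\<close>.\<close>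
  have root_disj: "root_edges (X i) \<inter> root_edges (X j) = {}" if ij: "i < m" "j < m" "i \<noteq> j" for i j
  proof (rule ccontr)
    assume "\<not> ?thesis"
    then obtain e where "e \<in> root_edges (X i)" "e \<in> root_edges (X j)" by blast
    then have e: "e \<in> J i" "e \<in> J (i + 1)" "e \<in> J j" "e \<in> J (j + 1)"
      using root_edges_DS[OF misJ] by (auto simp: X_def B_def root_edges_Int)
    show False
    proof (cases "J j = J (i + 1)")
      case False
      then show False
        using no_edge_in_three_mis[OF misJ[of i] misJ[of "i + 1"] misJ[of j]] e J_eq neq1[of i] ij by auto
    next
      case True
      then have "J (j + 1) = J (i + 2)"
        using J_eq[of j "i + 1"] J_eq[of "j + 1" "i + 2"] by (metis add_2_eq_Suc' mod_Suc_eq Suc_eq_plus1)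
      then show False
        using no_edge_in_three_mis[OF misJ[of i] misJ[of "i + 1"] misJ[of "i + 2"]] e
          J_eq neq1[of i] neq2[of i] neq1[of "i + 1"] by auto
    qed
  qed
  have disj: "X i \<inter> X j = {}" if ij: "i < m" "j < m" "i \<noteq> j" for i j
  proof -
    obtain e where e: "root_edges (X i) = {e}"
      using root_edges_linked_single[OF link[of i]] by (auto simp: X_def)
    obtain f where f: "root_edges (X j) = {f}"
      using root_edges_linked_single[OF link[of j]] by (auto simp: X_def)
    \<comment> \<open>The two blobs have one root edge each; the degree of \<open>s\<close> supplies
      a further edge \<open>g\<close>.\<close>
    have "card {e, f} \<le> 2" using card_insert_le_m1[of 2 "{f}" e] by simp
    then have "\<not> edges_at G s \<subseteq> {e, f}"
      using deg card_mono[of "{e, f}" "edges_at G s"] by (auto simp: degree_def)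
    then obtain g where g: "g \<in> edges_at G s" "g \<noteq> e" "g \<noteq> f" by blast
    show ?thesis
      by (rule tight_root_disjoint[OF odd X_sub dX X_sub dX root_disj[OF ij] _ _ g(1)])
        (use e f g in auto)
  qed
  have cover: "(\<Union>i<m. X i) = W"
  proof (rule ccontr)
    assume n: "\<not> ?thesis"
    \<comment> \<open>The uncovered set \<open>Z\<close> has no edges to \<open>s\<close> and none
      to the blobs, so its cut would be empty.\<close>
    define Z where "Z = W - (\<Union>i<m. X i)"
    have XU: "X i \<subseteq> (\<Union>i<m. X i)" for i
      using X_mod[of i] mod_less_divisor[of m i] m by (metis UN_upper lessThan_iff less_le_trans zero_less_numeral)
    have Bi: "B i \<subseteq> (\<Union>i<m. X i)" for i
    proof -
      have "B i = B (i + m)" using J_eq[of i "i + m"] by (simp add: B_def)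
      then show ?thesis using two(1)[of "i + m - 1"] XU m by simp
    qed
    have "X 0 \<noteq> {}" using link[of 0] linkedD(5)[of "B 0" "B (0 + 1)"] by (auto simp: X_def)
    then obtain x where "x \<in> X 0" by blast
    then have "x \<in> W" "x \<notin> Z" using XU[of 0] X_sub[of 0] unfolding Z_def by blast+
    moreover have "(\<Union>i<m. X i) \<subseteq> W" using X_sub by (intro UN_least)
    ultimately have Z: "Z \<subseteq> W" "Z \<noteq> {}" "Z \<noteq> W" using n unfolding Z_def by blast+
    have "nb Z = 0"
    proof (rule nb_outside_cover[OF Z(1)])
      fix F assume "mis F"
      then have "F \<in> I ` {1..m}" using bij by (simp add: bij_betw_def)
      then obtain i where i: "i \<in> {1..m}" "F = I i" by blast
      then have "F = J i" using c_id by (simp add: J_def)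
      then show "DS F \<inter> Z = {}" using Bi[of i] by (auto simp: Z_def B_def)
    qed
    moreover have "ee Z (W - Z) = 0"
    proof -
      have "edges_between G Z (X i) = {}" for i
        unfolding X_def
        by (rule no_edge_leaving_linked[OF link Z(1)]) (use Bi[of i] Bi[of "i + 1"] Z_def in auto)
      moreover have "W - Z = (\<Union>i<m. X i)" using X_sub by (auto simp: Z_def)
      ultimately have "edges_between G Z (W - Z) = {}"
        by (auto simp: edges_between_def)
      then show ?thesis by simp
    qed
    ultimately show False using d_root_split[OF Z(1)] d_ge_k[OF Z] k_ge_2 by simp
  qed
  let ?H = "\<lambda>i. induced_subgraph G (if i = 0 then A m \<inter> A 1 else A i \<inter> A (i + 1))"
  have H: "?H i = induced_subgraph G (X i)" if "i < m" for i using X_eq[OF that] by simp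
  have "blobs G s m ?H"
    unfolding blobs_def
  proof (intro conjI allI impI)
    fix i assume "i < m"
    then show "subgraph (?H i) (delete_vertex G s)" using H X_sub subgraph_induced by simp
  next
    fix i j assume "i < m" "j < m" "i \<noteq> j"
    then show "vertices (?H i) \<inter> vertices (?H j) = {}"
      using disj H[of i] H[of j] by (metis vertices_induced_subgraph)
  next
    have "(\<Union>i<m. vertices (?H i)) = (\<Union>i<m. X i)" using X_eq by simp
    then show "(\<Union>i<m. vertices (?H i)) = vertices (delete_vertex G s)"
      using cover by (simp add: delete_vertex_def)
  qed (use m in simp)
  moreover have "regular_blob G s ((k - 1) div 2) (?H ((i + m - 1) mod m)) (?H i) (?H ((i + 1) mod m))"
    if i: "i < m" for i
  proof -
    have lt: "(i + m - 1) mod m < m" "(i + 1) mod m < m" using m by auto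
    have "X (i + m - 1 + 1) = X i" using X_mod[of "i + m"] X_mod[of i] m by simp
    moreover have "X (i + m - 1 + 2) = X (i + 1)"
    proof -
      have "i + m - 1 + 2 = i + 1 + m" using m by simp
      then show ?thesis using X_mod[of "i + 1 + m"] X_mod[of "i + 1"] by (metis mod_add_self2)
    qed
    ultimately show ?thesis
      using regular[of "i + m - 1"] H[OF i] H[OF lt(1)] H[OF lt(2)] X_mod[of "i + m - 1"] X_mod[of "i + 1"]
      by metis
  qed
  ultimately show "cycle_structure G s ((k - 1) div 2) m ?H"
    unfolding cycle_structure_def using half_pos[OF odd] by blast
qed

lemma path_case:
  assumes pth: "path_order IL m I" and A: "\<And>i. i \<in> {1..m} \<Longrightarrow> A i = DS (I i)"
  shows "odd k" and "path_structure G s ((k - 1) div 2) (m + 1)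
    (\<lambda>i. induced_subgraph G (if i = 0 then A 1 - A 2 else if i = m then A m - A (m - 1)
       else A i \<inter> A (i + 1)))"
proof -
  define X where "X i = (if i = 0 then A 1 - A 2 else if i = m then A m - A (m - 1)
     else A i \<inter> A (i + 1))" for i
  have m1: "1 \<le> m" and bij: "bij_betw I {1..m} {F. mis F}"
    and adj: "\<And>i j. i \<in> {1..m} \<Longrightarrow> j \<in> {1..m} \<Longrightarrow> adjacent IL (I i) (I j) \<longleftrightarrow>
        j = i + 1 \<or> i = j + 1"
    using pth by (auto simp: path_order_def vertices_IL)
  have misI: "mis (I i)" if "i \<in> {1..m}" for i using bij that by (auto simp: bij_betw_def)
  have I_eq: "I i = I j \<longleftrightarrow> i = j" if "i \<in> {1..m}" "j \<in> {1..m}" for i j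
    using bij that by (meson bij_betw_imp_inj_on inj_on_eq_iff)
  have mis_I: "\<exists>i\<in>{1..m}. F = I i" if "mis F" for F
  proof -
    have "F \<in> I ` {1..m}" using bij that by (simp add: bij_betw_def)
    then show ?thesis by blast
  qed
  \<comment> \<open>A single maximal independent set would contain every edge at \<open>s\<close>,
    but \<open>L\<close> has an adjacent pair.\<close>
  have "m \<noteq> 1"
  proof
    assume "m = 1"
    then have one: "F = I 1" if "mis F" for F using mis_I[OF that] by auto
    obtain e where e: "e \<in> edges_at G s" using deg by (fastforce simp: degree_def)
    obtain f where f: "adjacent L e f" using has_lift_neighbour[OF e] .
    then have "e \<in> I 1" "f \<in> I 1" using root_edge_in_mis[of e] root_edge_in_mis[of f] one
      by (auto simp: adjacent_L)
    then show False using f misI[of 1] m1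
      by (auto simp: max_independent_set_def independent_set_def)
  qed
  then have m: "2 \<le> m" using m1 by simp
  have link: "linked (A i) (A (i + 1))" if "1 \<le> i" "i < m" for i
  proof -
    have i: "i \<in> {1..m}" "i + 1 \<in> {1..m}" using that by auto
    then have "I i \<inter> I (i + 1) \<noteq> {}" "I i \<noteq> I (i + 1)"
      using adj[OF i] by (auto simp: adjacent_IL)
    then show ?thesis using mis_linked[OF misI[OF i(1)] misI[OF i(2)]] A i by auto
  qed
  show odd: "odd k" using linkedD(1)[OF link[of 1]] m by simp
  have rootA: "root_edges (A i) = I i" if "i \<in> {1..m}" for i
    using root_edges_DS[OF misI[OF that]] A[OF that] by simp
  have A_sub: "A i \<subseteq> W" if "i \<in> {1..m}" for i using DS_sub[OF misI[OF that]] A[OF that] by simp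
  have X0: "X 0 = A 1 - A 2" and Xm: "X m = A m - A (m - 1)"
    and Xi: "\<And>i. 1 \<le> i \<Longrightarrow> i < m \<Longrightarrow> X i = A i \<inter> A (i + 1)" using m by (auto simp: X_def)
  \<comment> \<open>With the end blobs taken as differences, \<open>A i\<close> splits into two
    consecutive blobs at the ends of the path as well as inside.\<close>
  have two: "A i = X (i - 1) \<union> X i \<and> X (i - 1) \<inter> X i = {}" if i: "1 \<le> i" "i \<le> m" for i
  proof -
    consider "i = 1" | "i = m" "1 < i" | "1 < i" "i < m" using i by linarith
    then show ?thesis
    proof cases
      case 1
      then show ?thesis using X0 Xi[of 1] m by (auto simp: numeral_2_eq_2)
    next
      case 2
      then have "X (i - 1) = A (m - 1) \<inter> A m" using Xi[of "m - 1"] m by auto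
      then show ?thesis using 2 Xm by auto
    next
      case 3
      have r: "i \<in> {1..m}" "i - 1 \<in> {1..m}" "i + 1 \<in> {1..m}" using 3 by auto
      have n: "I i \<noteq> I (i - 1)" "I i \<noteq> I (i + 1)" "I (i - 1) \<noteq> I (i + 1)"
        using I_eq r 3 by auto
      have mt: "I i \<inter> I (i - 1) \<noteq> {}" "I i \<inter> I (i + 1) \<noteq> {}"
        using adj[OF r(1,2)] adj[OF r(1,3)] 3 by (auto simp: adjacent_IL)
      note tw = mis_two_neighbours(1,2)[OF misI[OF r(1)] misI[OF r(2)] misI[OF r(3)] n mt]
      have "X (i - 1) = A i \<inter> A (i - 1)" "X i = A i \<inter> A (i + 1)"
        using Xi[of "i - 1"] Xi[of i] 3 by auto
      then show ?thesis using tw A r by auto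
    qed
  qed
  have X_in_next: "X i \<subseteq> A (i + 1)" if "i < m" for i using two[of "i + 1"] that by auto
  have X_in_self: "X i \<subseteq> A i" if "1 \<le> i" "i \<le> m" for i using two[of i] that by auto
  have X_sub: "X i \<subseteq> W" if "i \<le> m" for i
    using that X_in_self[of i] A_sub[of i] X_in_next[of 0] A_sub[of 1] m by (cases "i = 0") auto
  have link_m: "linked (A m) (A (m - 1))" using link[of "m - 1"] m linked_commute by auto
  have dX: "d (X i) = k" if im: "i \<le> m" for i
  proof -
    consider "i = 0" | "i = m" | "1 \<le> i" "i < m" using im by linarith
    then show ?thesis
    proof cases
      case 1
      then show ?thesis using linkedD(4)[OF link[of 1]] m X0 by (simp add: numeral_2_eq_2)
    next
      case 2
      then show ?thesis using linkedD(4)[OF link_m] Xm by simp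
    next
      case 3
      then show ?thesis using linkedD(3)[OF link[OF 3]] Xi by simp
    qed
  qed
  have regular: "regular_blob G s ((k - 1) div 2) (induced_subgraph G (X (i - 1)))
      (induced_subgraph G (X i)) (induced_subgraph G (X (i + 1)))" if i: "1 \<le> i" "i < m" for i
  proof -
    have "A i - A (i + 1) = X (i - 1)" "A i \<inter> A (i + 1) = X i" "A (i + 1) - A i = X (i + 1)"
      using two[of i] two[of "i + 1"] Xi[OF i] i by auto
    then show ?thesis using regular_blob_linked[OF link[OF i]] by simp
  qed
  have root_ne: "root_edges (X i) \<noteq> {}" if im: "i \<le> m" for i
  proof -
    have diff: "root_edges (A i - A j) \<noteq> {}" if "i \<in> {1..m}" "j \<in> {1..m}" "i \<noteq> j" for i j
    proof -
      have "\<not> I i \<subseteq> I j" using mis_subset_eq[OF misI[OF that(1)] misI[OF that(2)]] I_eq that by auto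
      then have "\<not> root_edges (A i) \<subseteq> root_edges (A j)" using rootA that by simp
      then show ?thesis by (auto simp: root_edges_def)
    qed
    consider "i = 0" | "i = m" | "1 \<le> i" "i < m" using im by linarith
    then show ?thesis
    proof cases
      case 1
      then show ?thesis using diff[of 1 2] m X0 by simp
    next
      case 2
      then show ?thesis using diff[of m "m - 1"] m Xm by auto
    next
      case 3
      then show ?thesis using root_edges_linked_single[OF link[OF 3]] Xi[OF 3] by auto
    qed
  qed
  have root_disj: "root_edges (X i) \<inter> root_edges (X j) = {}" if ij: "i < j" "j \<le> m" for i j
  proof (cases "j = i + 1")
    case True
    then have "X i \<inter> X j = {}" using two[of j] ij by auto
    then show ?thesis by (auto simp: root_edges_def)
  next
    case False
    show ?thesis
    proof (rule ccontr)
      assume "\<not> ?thesis"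
      then obtain e where e: "e \<in> root_edges (X i)" "e \<in> root_edges (X j)" by blast
      have r: "i + 1 \<in> {1..m}" "j \<in> {1..m}" using ij by auto
      have in1: "e \<in> I (i + 1)" using e(1) root_edges_mono[OF X_in_next[of i]] rootA[OF r(1)] ij by auto
      have in2: "e \<in> I j" using e(2) root_edges_mono[OF X_in_self[of j]] rootA[OF r(2)] ij by auto
      have "adjacent IL (I (i + 1)) (I j)"
        using in1 in2 misI[OF r(1)] misI[OF r(2)] I_eq[OF r] False by (auto simp: adjacent_IL)
      \<comment> \<open>Intersecting sets are consecutive on the path. For \<open>i = 0\<close> the
        difference \<open>A 1 - A 2\<close> excludes the end of \<open>e\<close> from
        \<open>A 2\<close>; otherwise \<open>e\<close> would lie in three maximal independent
        sets.\<close>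
      then have j: "j = i + 2" using adj[OF r] False ij by auto
      show False
      proof (cases "i = 0")
        case True
        then have "e \<in> root_edges (A 1 - A 2)" "e \<in> root_edges (A 2)"
          using e(1) in2 rootA[OF r(2)] X0 j by (auto simp: numeral_2_eq_2)
        then show False by (auto simp: root_edges_def)
      next
        case False
        then have r0: "i \<in> {1..m}" using ij by auto
        have "e \<in> I i" using e(1) root_edges_mono[OF X_in_self[of i]] rootA[OF r0] r0 by auto
        then show False
          using no_edge_in_three_mis[OF misI[OF r0] misI[OF r(1)] misI[OF r(2)]] in1 in2
            I_eq[OF r0 r(1)] I_eq[OF r0 r(2)] I_eq[OF r] j by auto
      qed
    qed
  qed
  have disj_less: "X i \<inter> X j = {}" if ij: "i < j" "j \<le> m" for i j
  proof (cases "j = i + 1")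
    case True
    then show ?thesis using two[of j] ij by auto
  next
    case False
    \<comment> \<open>The blob \<open>X (i + 1)\<close> lies strictly between the two and supplies a
      root edge outside both.\<close>
    obtain g where g: "g \<in> root_edges (X (i + 1))" using root_ne[of "i + 1"] ij by auto
    have "i \<le> m" using ij by simp
    show ?thesis
    proof (rule tight_root_disjoint[OF odd X_sub dX X_sub dX root_disj[OF ij]])
      show "g \<in> edges_at G s" using g by (simp add: root_edges_def)
      show "g \<notin> root_edges (X i)" using root_disj[of i "i + 1"] g ij by auto
      show "g \<notin> root_edges (X j)" using root_disj[of "i + 1" j] g ij False by auto
    qed (use ij root_ne \<open>i \<le> m\<close> in auto)
  qed
  \<comment> \<open>Unlike on a cycle, an uncovered set \<open>Z\<close> might have edges to the two
    end blobs. By \<open>tight_end_bound\<close> each of them sends at most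
    \<open>(k - 1) div 2\<close> edges to \<open>Z\<close>, so \<open>d Z \<le> k - 1\<close>, which
    is too small.\<close>
  have cover: "(\<Union>i<m + 1. X i) = W"
  proof (rule ccontr)
    assume n: "\<not> ?thesis"
    define U where "U = (\<Union>i<m + 1. X i)"
    define Z where "Z = W - U"
    have XU: "X i \<subseteq> U" if "i \<le> m" for i using that unfolding U_def by (intro UN_upper) auto
    have AU: "A i \<subseteq> U" if "i \<in> {1..m}" for i
    proof -
      have "1 \<le> i" "i \<le> m" "i - 1 \<le> m" using that by auto
      then show ?thesis using two[of i] XU[of i] XU[of "i - 1"] by blast
    qed
    have UW: "U \<subseteq> W" using X_sub unfolding U_def by (intro UN_least) auto
    have "X 0 \<noteq> {}" using root_ne[of 0] by (auto simp: root_edges_def)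
    then obtain x where "x \<in> X 0" by blast
    then have "x \<in> W" "x \<notin> Z" using XU[of 0] UW unfolding Z_def by blast+
    then have Z: "Z \<subseteq> W" "Z \<noteq> {}" "Z \<noteq> W"
      using n UW unfolding Z_def U_def[symmetric] by blast+
    have nbZ: "nb Z = 0"
    proof (rule nb_outside_cover[OF Z(1)])
      fix F assume "mis F"
      then obtain i where i: "i \<in> {1..m}" "F = I i" using mis_I by blast
      then show "DS F \<inter> Z = {}" using AU[OF i(1)] A[OF i(1)] by (auto simp: Z_def)
    qed
    have inner: "edges_between G Z (X i) = {}" if i: "1 \<le> i" "i < m" for i
      unfolding Xi[OF i]
      by (rule no_edge_leaving_linked[OF link[OF i] Z(1)])
        (use AU[of i] AU[of "i + 1"] i Z_def in auto)
    have "edges_between G Z (W - Z) \<subseteq> edges_between G Z (X 0) \<union> edges_between G Z (X m)"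
    proof
      fix e assume e: "e \<in> edges_between G Z (W - Z)"
      then obtain z u where zu: "e \<in> edges G" "z \<in> Z" "u \<in> U" "ends G e = {z, u}"
        by (auto simp: edges_between_def Z_def)
      then obtain i where i: "i \<le> m" "u \<in> X i" by (auto simp: U_def less_Suc_eq_le)
      then have ei: "e \<in> edges_between G Z (X i)" using zu by (auto simp: edges_between_def)
      then have "\<not> (1 \<le> i \<and> i < m)" using inner[of i] by auto
      then have "i = 0 \<or> i = m" using i by linarith
      then show "e \<in> edges_between G Z (X 0) \<union> edges_between G Z (X m)" using ei by auto
    qed
    then have "ee Z (W - Z) \<le> card (edges_between G Z (X 0) \<union> edges_between G Z (X m))"
      using fin_between by (intro card_mono) auto
    also have "\<dots> \<le> ee Z (X 0) + ee Z (X m)" by (rule card_Un_le)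
    finally have le: "ee Z (W - Z) \<le> ee Z (X 0) + ee Z (X m)" .
    have nb1: "1 \<le> nb (X i)" if "i \<le> m" for i
      using root_ne[OF that] nb_ge_1[OF X_sub[OF that]] by auto
    have XZ: "X i \<inter> Z = {}" if "i \<le> m" for i using XU[OF that] by (auto simp: Z_def)
    have "ee (X 0) Z \<le> (k - 1) div 2"
    proof (rule tight_end_bound[OF odd, where Y = "X 1"])
      show "ee (X 0) (X 1) = (k - 1) div 2"
        using linkedD(7)[OF link[of 1]] X0 Xi[of 1] m ee_commute[of "X 0" "X 1"]
        by (simp add: numeral_2_eq_2)
    qed (use X_sub[of 0] X_sub[of 1] dX[of 0] nb1[of 0] disj_less[of 0 1] XZ[of 0] XZ[of 1] Z m in auto)
    moreover have "ee (X m) Z \<le> (k - 1) div 2"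
    proof (rule tight_end_bound[OF odd, where Y = "X (m - 1)"])
      have "X (m - 1) = A m \<inter> A (m - 1)" using Xi[of "m - 1"] m by auto
      then show "ee (X m) (X (m - 1)) = (k - 1) div 2"
        using linkedD(7)[OF link_m] Xm ee_commute[of "X m" "X (m - 1)"] by simp
      show "X m \<inter> X (m - 1) = {}" using disj_less[of "m - 1" m] m by auto
    qed (use X_sub[of m] X_sub[of "m - 1"] dX[of m] nb1[of m] XZ[of m] XZ[of "m - 1"] Z m in auto)
    ultimately have "ee Z (W - Z) \<le> 2 * ((k - 1) div 2)"
      using le ee_commute[of Z "X 0"] ee_commute[of Z "X m"] by linarith
    moreover have "k = 2 * ((k - 1) div 2) + 1" using odd by (auto elim: oddE)
    ultimately show False using d_root_split[OF Z(1)] d_ge_k[OF Z] nbZ by linarith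
  qed
  have "blobs G s (m + 1) (\<lambda>i. induced_subgraph G (X i))"
    unfolding blobs_def
  proof (intro conjI allI impI)
    fix i assume "i < m + 1"
    then show "subgraph (induced_subgraph G (X i)) (delete_vertex G s)"
      using X_sub subgraph_induced by simp
  next
    fix i j assume "i < m + 1" "j < m + 1" "i \<noteq> j"
    then show "vertices (induced_subgraph G (X i)) \<inter> vertices (induced_subgraph G (X j)) = {}"
      using disj_less[of i j] disj_less[of j i] by (cases "i < j") (auto simp: Int_commute)
  next
    show "(\<Union>i<m + 1. vertices (induced_subgraph G (X i))) = vertices (delete_vertex G s)"
      using cover by (simp add: delete_vertex_def)
  qed (use m in simp)
  moreover have "1 \<le> i \<and> i < m" if "i \<in> {1..m + 1 - 2}" for i using that by auto
  ultimately have "path_structure G s ((k - 1) div 2) (m + 1) (\<lambda>i. induced_subgraph G (X i))"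
    unfolding path_structure_def using half_pos[OF odd] regular by blast
  then show "path_structure G s ((k - 1) div 2) (m + 1)
    (\<lambda>i. induced_subgraph G (if i = 0 then A 1 - A 2 else if i = m then A m - A (m - 1)
       else A i \<inter> A (i + 1)))" unfolding X_def .
qed

end

text \<open>\<open>odd k\<close> is part of both conclusions so that \<open>(k - 1) div 2\<close> is
  exactly half of \<open>k - 1\<close>. Blobs are numbered from 0 and the sets \<open>A i\<close>
  from 1: blob 0 closes the cycle in the first case and is an end of the path in the second.\<close>

theorem theorem6p1:
  fixes G :: "('v, 'e) mgraph" and s :: 'v and k m :: nat
    and I :: "nat \<Rightarrow> 'e set" and A :: "nat \<Rightarrow> 'v set"
  assumes "multigraph G"
    and "sk_edge_connected G s k"
    and "k \<ge> 2"
    and "degree G s > 4"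
    and "connected_graph (lifting_graph G s k)"
    and "connected_graph (complement_graph (lifting_graph G s k))"
    and "\<And>i. i \<in> {1..m} \<Longrightarrow> A i = dangerous_set_of G s k (I i)"
  shows "(is_path_graph (independence_graph (lifting_graph G s k)) \<or>
          is_cycle_graph (independence_graph (lifting_graph G s k))) \<and>
         (cycle_order (independence_graph (lifting_graph G s k)) m I \<longrightarrow>
            odd k \<and>
            cycle_structure G s ((k - 1) div 2) m
              (\<lambda>i. induced_subgraph G (if i = 0 then A m \<inter> A 1 else A i \<inter> A (i + 1)))) \<and>
         (path_order (independence_graph (lifting_graph G s k)) m I \<longrightarrow>
            odd k \<and>
            path_structure G s ((k - 1) div 2) (m + 1)
              (\<lambda>i. induced_subgraph G
                     (if i = 0 then A 1 - A 2
                      else if i = m then A m - A (m - 1)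
                      else A i \<inter> A (i + 1))))"
proof -
  interpret lifting_connected G s k
    using assms by unfold_locales (simp_all add: sk_edge_connected_def)
  show ?thesis
    using IL_path_or_cycle cycle_case[of m I A] path_case[of m I A] assms(7) by blast
qed

end
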